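(* Let $d_1,d_2,d_3>0$, and consider the two tetrahedra $P_1P_2P_3P_4$ (fixed) and $Q_1Q_2Q_3Q_4$ (moving) derived from the rectangular parallelepiped with vertices $(\pm d_1,\pm d_2,\pm d_3)$, where $P_1=(d_1,-d_2,-d_3)$, $P_2=(-d_1,d_2,-d_3)$, $P_3=(-d_1,-d_2,d_3)$, $P_4=(d_1,d_2,d_3)$, and in the basic position $Q_i$ is $-P_i$. The only finite motions admitted by these tetrahedra (i.e. all positions of the moving tetrahedron satisfying the coplanarity constraints) are: the motions of the first kind, of the intermediate kind, of the third kind, of the fifth kind and, provided that $d_k=d_id_j/(d_i^2+d_j^2)^{1/2}$ for some permutation $(ijk)$ of $\{1,2,3\}$, of the sixth kind. In other words, the set of all admitted motions is exactly the union of the sets of motions of these kinds.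
   Context: A motion is an isometry $\Phi(x)=Ax+b$ of $\mathbb{R}^3$ with $A\in SO(3)$, $b\in\mathbb{R}^3$; it moves the moving tetrahedron from its basic position, so that its vertices become $Q_i=\Phi(-P_i)$, $i=1,\dots,4$, while $P_1P_2P_3P_4$ stays fixed. The motion $\Phi$ is admitted if each pair of edges, one from each tetrahedron, that in the basic position are the two diagonals of a face of the parallelepiped remains coplanar; that is, for every permutation $(ijkl)$ of $\{1,2,3,4\}$ the four points $P_i,P_j,\Phi(-P_k),\Phi(-P_l)$ are coplanar. (No continuous connection with the basic position is required.) Notation: $e_1,e_2,e_3$ is the standard basis; for a unit vector $u$ and an angle $\varphi$ (mod $2\pi$), $R(u,\varphi)$ is the rotation about the axis $\mathbb{R}u$ through the angle $\varphi$; $D_i=d_i^{-2}$. Below $(ijk)$ denotes a permutation of $\{1,2,3\}$. First kind: $\Phi(x)=R(e_i,\varphi)x$ with $i\in\{1,2,3\}$ and $\varphi$ arbitrary (so $b=0$). Intermediate kind: $A=R(u,\varphi)$ where $u$ is a unit vector of the form $C_1e_i+C_2e_j$ ($C_1,C_2$ real), $\varphi\not\equiv\pi \pmod{2\pi}$, and $b=\tau\,R(u,\varphi/2)e_k$, where $\tau$ is the real number for which the motion is admitted; for all such $u,\varphi$ there is exactly one such $\tau$. (Equivalently, up to a common rigid motion: the fixed and moving tetrahedra in basic position are rotated about $\mathbb{R}u$ through $-\varphi/2$ and $\varphi/2$, respectively, and then translated by opposite multiples $-\tfrac{\tau}{2}e_k$ and $\tfrac{\tau}{2}e_k$, so that the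 configuration stays symmetric with respect to the plane spanned by $e_i,e_j$, until all coplanarity conditions hold.) Third kind: $A=R(u,\varphi)$ with $0<\varphi<2\pi$, $\varphi\ne\pi/2,3\pi/2$, and, with $s=\cot(\varphi/2)$, $$\frac{s^4+3s^2+1}{3s^4+7s^2+1}>\frac{\max_i D_i}{D_1+D_2+D_3},\qquad u_i^2=\frac{(s^4+3s^2+1)-(3s^4+7s^2+1)D_i/(D_1+D_2+D_3)}{2(s^2+1)}\quad(i=1,2,3),$$ the signs of the coordinates $u_1,u_2,u_3$ of $u$ being arbitrary (then $u_1^2+u_2^2+u_3^2=1$ and each $u_i^2>0$), and $b$ is the vector for which the motion is admitted; for each such $A$ there is exactly one such $b$. Fifth kind: $A=R(e_i,\pi)$ and $b=C_1e_j+C_2e_k$ with $C_1,C_2$ arbitrary reals. Sixth kind (defined for those permutations $(ijk)$ with $d_k=d_id_j/(d_i^2+d_j^2)^{1/2}$): $A=R(u,\varphi)$ with $u=(\pm d_ie_i\pm d_je_j)/(d_i^2+d_j^2)^{1/2}$ (arbitrary signs; i.e. the axis is parallel to a diagonal of a face perpendicular to $e_k$), $\varphi=\pm\pi/2$, and $b=b_0+\lambda u$, where $b_0=\tau R(u,\varphi/2)e_k$ is the translation part of the motion of the intermediate kind with the same $u,\varphi$, and $\lambda\in\mathbb{R}$ is arbitrary.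
   Formalization: In the third kind, s^4+3s^2+1 and 3s^4+7s^2+1 are replaced by s^4+2s^2+1 and 3s^4+4s^2+1 (in the inequality and in u_i^2); with the printed polynomials the claim fails, e.g. for d=(1,2,2), axis (1,2,2)/3, cot^2(φ/2)=1/9. *)

theory Defs
  imports "HOL-Analysis.Analysis"
begin

abbreviation ebasis :: "3 \<Rightarrow> real^3" where
  "ebasis i \<equiv> axis i 1"

(* Rotation about the axis spanned by the unit vector u through the angle \<phi>
   (Rodrigues' formula, right-handed). *)
definition rot :: "real^3 \<Rightarrow> real \<Rightarrow> real^3 \<Rightarrow> real^3" where
  "rot u \<phi> x = cos \<phi> *\<^sub>R x + sin \<phi> *\<^sub>R cross3 u x + ((1 - cos \<phi>) * (u \<bullet> x)) *\<^sub>R u"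

definition vert :: "real^3 \<Rightarrow> 4 \<Rightarrow> real^3" where
  "vert d i =
     (if i = 1 then vector [  d$1, - d$2, - d$3]
      else if i = 2 then vector [- d$1,   d$2, - d$3]
      else if i = 3 then vector [- d$1, - d$2,   d$3]
      else vector [d$1, d$2, d$3])"

definition motion :: "(real^3 \<Rightarrow> real^3) \<Rightarrow> bool" where
  "motion \<Phi> \<longleftrightarrow> (\<exists>A b. rotation_matrix A \<and> \<Phi> = (\<lambda>x. A *v x + b))"

(* A list of four distinct elements of the four-element type 4 is a permutation of
   {1,2,3,4}; likewise below for three distinct elements of the type 3. *)
definition admitted :: "real^3 \<Rightarrow> (real^3 \<Rightarrow> real^3) \<Rightarrow> bool" where
  "admitted d \<Phi> \<longleftrightarrow> motion \<Phi> \<and>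
     (\<forall>i j k l :: 4. distinct [i, j, k, l] \<longrightarrow>
        coplanar {vert d i, vert d j, \<Phi> (- vert d k), \<Phi> (- vert d l)})"

definition Dinv :: "real^3 \<Rightarrow> 3 \<Rightarrow> real" where
  "Dinv d i = 1 / (d$i)\<^sup>2"

definition first_kind :: "(real^3 \<Rightarrow> real^3) set" where
  "first_kind = {\<Phi>. \<exists>i \<phi>. \<Phi> = rot (ebasis i) \<phi>}"

definition inter_motion :: "3 \<Rightarrow> real^3 \<Rightarrow> real \<Rightarrow> real \<Rightarrow> real^3 \<Rightarrow> real^3" where
  "inter_motion k u \<phi> \<tau> = (\<lambda>x. rot u \<phi> x + \<tau> *\<^sub>R rot u (\<phi>/2) (ebasis k))"

definition inter_data :: "3 \<Rightarrow> real^3 \<Rightarrow> real \<Rightarrow> bool" where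
  "inter_data k u \<phi> \<longleftrightarrow>
     (\<exists>i j C1 C2. distinct [i, j, k] \<and> u = C1 *\<^sub>R ebasis i + C2 *\<^sub>R ebasis j) \<and> norm u = 1 \<and>
     (\<forall>n::int. \<phi> \<noteq> pi + of_int n * (2 * pi))"

definition inter_tau :: "real^3 \<Rightarrow> 3 \<Rightarrow> real^3 \<Rightarrow> real \<Rightarrow> real" where
  "inter_tau d k u \<phi> = (THE \<tau>. admitted d (inter_motion k u \<phi> \<tau>))"

definition intermediate_kind :: "real^3 \<Rightarrow> (real^3 \<Rightarrow> real^3) set" where
  "intermediate_kind d =
     {\<Phi>. \<exists>k u \<phi>. inter_data k u \<phi> \<and> \<Phi> = inter_motion k u \<phi> (inter_tau d k u \<phi>)}"

(* Correction of the source. The source has s^4 + 3 s^2 + 1 and 3 s^4 + 7 s^2 + 1 in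
   place of third_num and third_den. With those polynomials the classification fails:
   for d = (1,2,2), the motion x |-> A x + b with
     A = [[-3/5, 0, 4/5], [4/5, 0, 3/5], [0, 1, 0]],   b = (4/5, 8/5, 4)
   is admitted; A has axis (1,2,2)/3 and cot^2(phi/2) = 1/9, while the source's formula
   would require u_1^2 = 11/180. With the coefficients below u_1^2 = 1/9.
   Note third_num = (s^2 + 1)^2 and third_den = (s^2 + 1) (3 s^2 + 1). *)
definition third_num :: "real \<Rightarrow> real" where
  "third_num s = s^4 + 2 * s^2 + 1"

definition third_den :: "real \<Rightarrow> real" where
  "third_den s = 3 * s^4 + 4 * s^2 + 1"

definition third_data :: "real^3 \<Rightarrow> real^3 \<Rightarrow> real \<Rightarrow> bool" where
  "third_data d u \<phi> \<longleftrightarrow>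
     norm u = 1 \<and> 0 < \<phi> \<and> \<phi> < 2 * pi \<and> \<phi> \<noteq> pi / 2 \<and> \<phi> \<noteq> 3 * pi / 2 \<and>
     (let s = cot (\<phi> / 2); S = Dinv d 1 + Dinv d 2 + Dinv d 3 in
        third_num s / third_den s > Max (range (Dinv d)) / S \<and>
        (\<forall>i. (u$i)\<^sup>2 = (third_num s - third_den s * (Dinv d i / S)) / (2 * (s^2 + 1))))"

definition third_b :: "real^3 \<Rightarrow> real^3 \<Rightarrow> real \<Rightarrow> real^3" where
  "third_b d u \<phi> = (THE b. admitted d (\<lambda>x. rot u \<phi> x + b))"

definition third_kind :: "real^3 \<Rightarrow> (real^3 \<Rightarrow> real^3) set" where
  "third_kind d =
     {\<Phi>. \<exists>u \<phi>. third_data d u \<phi> \<and> \<Phi> = (\<lambda>x. rot u \<phi> x + third_b d u \<phi>)}"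

definition fifth_kind :: "(real^3 \<Rightarrow> real^3) set" where
  "fifth_kind =
     {\<Phi>. \<exists>i j k C1 C2. distinct [i, j, k] \<and>
        \<Phi> = (\<lambda>x. rot (ebasis i) pi x + (C1 *\<^sub>R ebasis j + C2 *\<^sub>R ebasis k))}"

(* Empty unless d_k = d_i d_j / sqrt (d_i^2 + d_j^2) for some permutation (ijk). *)
definition sixth_kind :: "real^3 \<Rightarrow> (real^3 \<Rightarrow> real^3) set" where
  "sixth_kind d =
     {\<Phi>. \<exists>i j k \<epsilon> \<delta> u \<phi> \<mu>. distinct [i, j, k] \<and>
        d$k = d$i * d$j / sqrt ((d$i)\<^sup>2 + (d$j)\<^sup>2) \<and>
        \<epsilon> \<in> {1, -1} \<and> \<delta> \<in> {1, -1} \<and>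
        u = (1 / sqrt ((d$i)\<^sup>2 + (d$j)\<^sup>2)) *\<^sub>R ((\<epsilon> * d$i) *\<^sub>R ebasis i + (\<delta> * d$j) *\<^sub>R ebasis j) \<and>
        \<phi> \<in> {pi / 2, - (pi / 2)} \<and>
        \<Phi> = (\<lambda>x. inter_motion k u \<phi> (inter_tau d k u \<phi>) x + \<mu> *\<^sub>R u)}"

end

theory Submission
  imports Defs
begin

text \<open>Write the motion as \<open>x \<mapsto> R(u,\<phi>)x + R(u,\<phi>/2)t\<close> with \<open>0 \<le> \<phi> \<le> \<pi>\<close>, and put \<open>c = cos(\<phi>/2)\<close>, \<open>s = sin(\<phi>/2)\<close>,
  \<open>w = u \<bullet> t\<close>, \<open>V = d\<^sub>1d\<^sub>2d\<^sub>3\<close>, \<open>S = D\<^sub>1 + D\<^sub>2 + D\<^sub>3\<close>. After rotating everything back by \<open>\<phi>/2\<close>, the sum and the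
  difference of the coplanarity conditions of two opposite faces become, when \<open>s \<noteq> 0\<close>,
  \<open>u\<^sub>it\<^sub>i = w(c + (1 - c)u\<^sub>i\<^sup>2 - 2cD\<^sub>i/S)\<close> and \<open>ct\<^sub>i + (2c\<^sup>2 - 1 - c)u\<^sub>iw = -2s\<^sup>2V(S - D\<^sub>i)u\<^sub>ju\<^sub>k\<close>.
  Multiplying the latter by \<open>u\<^sub>i\<close> and summing gives \<open>(2c\<^sup>2 - 1)w = -4s\<^sup>2VS u\<^sub>1u\<^sub>2u\<^sub>3\<close>.
  If \<open>u\<^sub>1u\<^sub>2u\<^sub>3 \<noteq> 0\<close>, then \<open>w\<close> can be eliminated, which determines every \<open>u\<^sub>i\<^sup>2\<close>: third kind.
  If \<open>u\<^sub>k = 0\<close>, then \<open>w = 0\<close> or \<open>2c\<^sup>2 = 1\<close>. For \<open>w = 0\<close> one gets the intermediate kind if \<open>c \<noteq> 0\<close> and the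
  fifth kind if \<open>c = 0\<close>. For \<open>w \<noteq> 0\<close> the equations force \<open>u\<^sub>i\<^sup>2 = 1 - 2D\<^sub>i/S\<close>, hence \<open>D\<^sub>k = D\<^sub>i + D\<^sub>j\<close>: sixth kind.\<close>

unbundle cross3_syntax

subsection \<open>Coplanarity and rotations\<close>

lemma coplanar_4_iff_triple_product:
  fixes a b c e :: "real^3"
  shows "coplanar {a, b, c, e} \<longleftrightarrow> (b - a) \<bullet> ((c - a) \<times> (e - a)) = 0"
proof
  assume "coplanar {a, b, c, e}"
  then obtain p q r where sub: "{a, b, c, e} \<subseteq> affine hull {p, q, r}"
    unfolding coplanar_def by blast
  \<comment> \<open>Affine coordinates based at \<open>p\<close>: all differences of the four points
    lie in the span of two vectors, so their triple product vanishes.\<close>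
  have ex: "\<exists>\<alpha> \<beta>. x = p + \<alpha> *\<^sub>R (q - p) + \<beta> *\<^sub>R (r - p)" if "x \<in> affine hull {p, q, r}" for x
  proof -
    from that obtain \<gamma> \<alpha> \<beta> where *: "x = \<gamma> *\<^sub>R p + \<alpha> *\<^sub>R q + \<beta> *\<^sub>R r" "\<gamma> + \<alpha> + \<beta> = 1"
      unfolding affine_hull_3 by blast
    then have "\<gamma> = 1 - \<alpha> - \<beta>" by simp
    with * have "x = p + \<alpha> *\<^sub>R (q - p) + \<beta> *\<^sub>R (r - p)" by (simp add: algebra_simps)
    then show ?thesis by blast
  qed
  obtain a1 a2 where a: "a = p + a1 *\<^sub>R (q - p) + a2 *\<^sub>R (r - p)" using ex[of a] sub by auto
  obtain b1 b2 where b: "b = p + b1 *\<^sub>R (q - p) + b2 *\<^sub>R (r - p)" using ex[of b] sub by auto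
  obtain c1 c2 where c: "c = p + c1 *\<^sub>R (q - p) + c2 *\<^sub>R (r - p)" using ex[of c] sub by auto
  obtain e1 e2 where e: "e = p + e1 *\<^sub>R (q - p) + e2 *\<^sub>R (r - p)" using ex[of e] sub by auto
  define v w where "v = q - p" and "w = r - p"
  have "b - a = (b1 - a1) *\<^sub>R v + (b2 - a2) *\<^sub>R w" "c - a = (c1 - a1) *\<^sub>R v + (c2 - a2) *\<^sub>R w"
    "e - a = (e1 - a1) *\<^sub>R v + (e2 - a2) *\<^sub>R w"
    unfolding a b c e v_def w_def by (simp_all add: algebra_simps)
  moreover have "w \<times> v = - (v \<times> w)" by (rule cross_skew)
  ultimately show "(b - a) \<bullet> ((c - a) \<times> (e - a)) = 0"
    by (simp add: cross_add_left cross_add_right cross_mult_left cross_mult_right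
        inner_add_left inner_add_right inner_diff_right dot_cross_self)
next
  assume 0: "(b - a) \<bullet> ((c - a) \<times> (e - a)) = 0"
  define v w x where "v = c - a" and "w = e - a" and "x = b - a"
  have e: "c = a + v" "e = a + w" "b = a + x" by (simp_all add: v_def w_def x_def)
  show "coplanar {a, b, c, e}"
  proof (cases "v \<times> w = 0")
    case True
    then have "collinear {0, v, w}" by (simp add: cross_eq_0)
    then consider "v = 0" | "w = 0" | k where "w = k *\<^sub>R v" by (auto simp: collinear_lemma)
    then show ?thesis
    proof cases
      case 3
      have "e \<in> affine hull {a, b, c}" unfolding affine_hull_3 e 3
        by (intro CollectI exI[of _ "1 - k"] exI[of _ "0::real"] exI[of _ k]) (simp add: algebra_simps)
      then have "{a, b, c, e} \<subseteq> affine hull {a, b, c}" by (auto intro: hull_inc)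
      then show ?thesis unfolding coplanar_def by blast
    next
      case 1
      then show ?thesis using coplanar_3[of a b e] by (simp add: e insert_commute)
    next
      case 2
      then show ?thesis using coplanar_3[of a b c] by (simp add: e insert_commute)
    qed
  next
    case False
    \<comment> \<open>As \<open>x\<close> is orthogonal to \<open>n\<close>, the double product
      \<open>n \<times> (n \<times> x)\<close> is \<open>- (n \<bullet> n) *\<^sub>R x\<close>.
      Expanding it with \<open>Lagrange\<close> exhibits \<open>x\<close> as a combination of
      \<open>v\<close> and \<open>w\<close>.\<close>
    define n where "n = v \<times> w"
    have nx: "n \<bullet> x = 0" using 0 by (simp add: n_def v_def w_def x_def inner_commute)
    have "n \<times> x = (x \<bullet> v) *\<^sub>R w - (x \<bullet> w) *\<^sub>R v"
      using Lagrange[of x v w] cross_skew[of n x] by (simp add: n_def)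
    moreover have "n \<times> v = (v \<bullet> v) *\<^sub>R w - (v \<bullet> w) *\<^sub>R v"
      using Lagrange[of v v w] cross_skew[of n v] by (simp add: n_def)
    moreover have "n \<times> w = (w \<bullet> v) *\<^sub>R w - (w \<bullet> w) *\<^sub>R v"
      using Lagrange[of w v w] cross_skew[of n w] by (simp add: n_def)
    moreover have "(n \<bullet> n) *\<^sub>R x = - (n \<times> (n \<times> x))"
      using Lagrange[of n n x] nx by simp
    ultimately have nnx: "(n \<bullet> n) *\<^sub>R x = 
       (- (x \<bullet> v)) *\<^sub>R ((w \<bullet> v) *\<^sub>R w - (w \<bullet> w) *\<^sub>R v) + (x \<bullet> w) *\<^sub>R ((v \<bullet> v) *\<^sub>R w - (v \<bullet> w) *\<^sub>R v)"
      by (simp add: Cross3.right_diff_distrib cross_mult_right)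
    \<comment> \<open>The coefficients of \<open>v\<close> and \<open>w\<close> in
      \<open>nnx\<close>, divided by \<open>n \<bullet> n\<close>.\<close>
    define \<alpha> where "\<alpha> = ((x \<bullet> v) * (w \<bullet> w) - (x \<bullet> w) * (v \<bullet> w)) / (n \<bullet> n)"
    define \<beta> where "\<beta> = ((x \<bullet> w) * (v \<bullet> v) - (x \<bullet> v) * (w \<bullet> v)) / (n \<bullet> n)"
    have n\<alpha>\<beta>: "(n \<bullet> n) * \<alpha> = (x \<bullet> v) * (w \<bullet> w) - (x \<bullet> w) * (v \<bullet> w)"
      "(n \<bullet> n) * \<beta> = (x \<bullet> w) * (v \<bullet> v) - (x \<bullet> v) * (w \<bullet> v)"
      using False by (simp_all add: \<alpha>_def \<beta>_def n_def)
    have "(n \<bullet> n) *\<^sub>R x = (n \<bullet> n) *\<^sub>R (\<alpha> *\<^sub>R v + \<beta> *\<^sub>R w)"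
      unfolding nnx scaleR_add_right scaleR_scaleR n\<alpha>\<beta> by (simp add: algebra_simps)
    then have x: "x = \<alpha> *\<^sub>R v + \<beta> *\<^sub>R w"
      using False by (metis inner_eq_zero_iff n_def scaleR_cancel_left)
    have "b \<in> affine hull {a, c, e}" unfolding affine_hull_3 e x
      by (intro CollectI exI[of _ "1 - \<alpha> - \<beta>"] exI[of _ \<alpha>] exI[of _ \<beta>]) (simp add: algebra_simps)
    then have "{a, b, c, e} \<subseteq> affine hull {a, c, e}" by (auto intro: hull_inc)
    then show ?thesis unfolding coplanar_def by blast
  qed
qed

section \<open>Rodrigues rotations and the axis-angle form of a rotation matrix\<close>

lemma linear_rot: "linear (rot u \<phi>)"
  by (auto intro!: linearI simp: rot_def cross_add_right cross_mult_right algebra_simps inner_add_right)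

lemma rot_components:
  "rot u \<phi> x $ 1 = cos \<phi> * x$1 + sin \<phi> * (u$2 * x$3 - u$3 * x$2) + (1 - cos \<phi>) * (u$1*x$1+u$2*x$2+u$3*x$3) * u$1"
  "rot u \<phi> x $ 2 = cos \<phi> * x$2 + sin \<phi> * (u$3 * x$1 - u$1 * x$3) + (1 - cos \<phi>) * (u$1*x$1+u$2*x$2+u$3*x$3) * u$2"
  "rot u \<phi> x $ 3 = cos \<phi> * x$3 + sin \<phi> * (u$1 * x$2 - u$2 * x$1) + (1 - cos \<phi>) * (u$1*x$1+u$2*x$2+u$3*x$3) * u$3"
  by (simp_all add: rot_def cross3_def inner_vec_def sum_3 mult.commute)

lemma norm_1_components: "norm (u :: real^3) = 1 \<longleftrightarrow> (u$1)\<^sup>2 + (u$2)\<^sup>2 + (u$3)\<^sup>2 = 1"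
  by (simp add: norm_eq_1 inner_vec_def sum_3 power2_eq_square)

lemma inner_rot_self:
  assumes "norm u = 1"
  shows "rot u \<phi> x \<bullet> rot u \<phi> x = x \<bullet> x"
proof -
  have "u \<bullet> u = 1" using assms by (simp add: norm_eq_1)
  have "(u \<times> x) \<bullet> (u \<times> x) = x \<bullet> x - (u \<bullet> x)\<^sup>2"
    using \<open>u \<bullet> u = 1\<close> by (simp add: dot_cross inner_commute power2_eq_square)
  moreover have "(sin \<phi>)\<^sup>2 = 1 - (cos \<phi>)\<^sup>2" by (simp add: sin_squared_eq)
  ultimately have "(sin \<phi>)\<^sup>2 * ((u \<times> x) \<bullet> (u \<times> x)) = (1 - (cos \<phi>)\<^sup>2) * (x \<bullet> x - (u \<bullet> x)\<^sup>2)" by simp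
  then show ?thesis using \<open>u \<bullet> u = 1\<close>
    by (simp add: rot_def inner_add_left inner_add_right dot_cross_self inner_commute algebra_simps power2_eq_square)
qed

lemma orthogonal_transformation_rot:
  assumes "norm u = 1"
  shows "orthogonal_transformation (rot u \<phi>)"
  using inner_rot_self[OF assms] by (simp add: orthogonal_transformation linear_rot norm_eq_sqrt_inner)

lemma inner_rot:
  assumes "norm u = 1"
  shows "rot u \<phi> x \<bullet> rot u \<phi> y = x \<bullet> y"
  using orthogonal_transformation_rot[OF assms] by (simp add: orthogonal_transformation_def)

lemma rotation_matrix_rot:
  assumes "norm u = 1"
  shows "rotation_matrix (matrix (rot u \<phi>))"
proof -
  note orthogonal_transformation_rot[OF assms, of \<phi>]
  moreover have "det (matrix (rot u \<phi>)) = 1"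
  proof -
    have "(u$1)\<^sup>2 + (u$2)\<^sup>2 + (u$3)\<^sup>2 = 1"
      using assms by (simp add: norm_1_components)
    note sq = this sin_cos_squared_add[of \<phi>]
    show ?thesis
      unfolding det_3 matrix_def
      by (simp add: rot_components axis_def) (use sq in algebra)
  qed
  ultimately show ?thesis
    by (simp add: rotation_matrix_def orthogonal_transformation_matrix)
qed

lemma rot_eq_matrix: "matrix (rot u \<phi>) *v x = rot u \<phi> x"
  by (simp add: linear_rot)

lemma cross_rot:
  assumes "norm u = 1"
  shows "rot u \<phi> x \<times> rot u \<phi> y = rot u \<phi> (x \<times> y)"
  using cross_rotation_matrix[OF rotation_matrix_rot[OF assms], of \<phi> x y] by (simp add: rot_eq_matrix)

lemma rot_add:
  assumes "norm u = 1"
  shows "rot u \<alpha> (rot u \<beta> x) = rot u (\<alpha> + \<beta>) x"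
proof -
  have "u \<bullet> u = 1" using assms by (simp add: norm_eq_1)
  then show ?thesis
    by (simp add: Lagrange rot_def cos_add sin_add inner_add_right cross_add_right Cross3.right_diff_distrib cross_mult_right dot_cross_self algebra_simps)
qed

lemma rot_0 [simp]: "rot u 0 x = x"
  by (simp add: rot_def)

lemma rot_axis_self: "norm u = 1 \<Longrightarrow> rot u \<phi> u = u"
  by (simp add: rot_def norm_eq_1 flip: scaleR_add_left)

lemma rot_half_cancel:
  assumes "norm u = 1"
  shows "rot u h (rot u (- h) b) = b" "rot u (- h) (rot u h b) = b"
  by (simp_all add: rot_add[OF assms])

text \<open>With \<open>w = u \<times> v\<close>, the double product
  \<open>w \<times> (w \<times> y)\<close> is minus the projection of \<open>y\<close> onto the
  plane of \<open>u\<close> and \<open>v\<close>, while \<open>Lagrange\<close> writes it as the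
  \<open>w\<close>-component of \<open>y\<close> minus \<open>y\<close>. This supplies the frame in
  which a rotation matrix is read off.\<close>

lemma orthonormal_expansion:
  fixes u v y :: "real^3"
  assumes "norm u = 1" "norm v = 1" "u \<bullet> v = 0"
  shows "y = (u \<bullet> y) *\<^sub>R u + (v \<bullet> y) *\<^sub>R v + ((u \<times> v) \<bullet> y) *\<^sub>R (u \<times> v)"
proof -
  define w where "w = u \<times> v"
  have uv: "u \<bullet> u = 1" "v \<bullet> v = 1" "v \<bullet> u = 0"
    using assms by (simp_all add: norm_eq_1 inner_commute)
  have "w \<bullet> w = 1" unfolding w_def dot_cross using uv by (simp add: inner_commute)
  have wu: "w \<times> u = v"
    using Lagrange[of u u v] cross_skew[of w u] uv by (simp add: w_def inner_commute)
  have wv: "w \<times> v = - u"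
    using Lagrange[of v u v] cross_skew[of w v] uv by (simp add: w_def)
  have "w \<times> y = (u \<bullet> y) *\<^sub>R v - (v \<bullet> y) *\<^sub>R u"
    using Lagrange[of y u v] cross_skew[of w y] by (simp add: w_def inner_commute)
  then have wwy: "w \<times> (w \<times> y) = - ((u \<bullet> y) *\<^sub>R u + (v \<bullet> y) *\<^sub>R v)"
    by (simp add: Cross3.right_diff_distrib cross_mult_right wu wv)
  have "y = (w \<bullet> y) *\<^sub>R w - w \<times> (w \<times> y)"
    by (subst Lagrange) (simp add: \<open>w \<bullet> w = 1\<close>)
  also have "\<dots> = (u \<bullet> y) *\<^sub>R u + (v \<bullet> y) *\<^sub>R v + (w \<bullet> y) *\<^sub>R w"
    unfolding wwy by simp
  finally show ?thesis unfolding w_def .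
qed

text \<open>Since \<^term>\<open>A - mat 1\<close> has determinant \<open>0\<close> in odd dimension, \<^term>\<open>A\<close> fixes a unit vector. Replacing that
  vector by its negative makes the sine of the angle nonnegative.\<close>

lemma rotation_matrix_imp_rot:
  assumes "rotation_matrix A"
  obtains u \<phi> where "norm u = 1" "0 \<le> \<phi>" "\<phi> \<le> pi" "\<And>x. A *v x = rot u \<phi> x"
proof -
  have oA: "orthogonal_matrix A" and dA: "det A = 1" using assms by (auto simp: rotation_matrix_def)
  have inn: "(A *v x) \<bullet> (A *v y) = x \<bullet> y" for x y
    using oA orthogonal_transformation_matrix[of "(*v) A"] by (simp add: orthogonal_transformation_def)
  have "det (A - mat 1) = 0"
  proof -
    have "det (A - mat 1) = det (transpose (A - mat 1))" by (simp add: det_transpose)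
    also have "transpose (A - mat 1) = transpose A - mat 1"
      by (simp add: transpose_def vec_eq_iff mat_def)
    \<comment> \<open>Orthogonality produces this factorization. Taking determinants gives
      \<open>det (A - mat 1) = det (mat 1 - A)\<close>, which in dimension 3 is its own
      negative.\<close>
    also have "\<dots> = transpose A ** (mat 1 - A)"
    proof -
      have "transpose A ** (mat 1 - A) + transpose A ** A = transpose A"
        by (simp flip: matrix_add_ldistrib)
      then show ?thesis using oA unfolding orthogonal_matrix_def by (metis add_diff_cancel_right')
    qed
    also have "det \<dots> = det (mat 1 - A)" using dA by (simp add: det_mul)
    also have "det (mat 1 - A) = - det (A - mat 1)" by (simp add: det_3 algebra_simps)
    finally show ?thesis by simp
  qed
  then obtain z where z: "z \<noteq> 0" "(A - mat 1) *v z = 0"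
    by (metis invertible_det_nz invertible_left_inverse matrix_left_invertible_ker)
  define u where "u = z /\<^sub>R norm z"
  have u: "norm u = 1" using z by (simp add: u_def)
  have "A *v z = z" using z by (simp add: matrix_vector_mult_diff_rdistrib)
  then have Au: "A *v u = u" by (simp add: u_def matrix_vector_mult_scaleR)
  obtain y where y: "y \<noteq> 0" "orthogonal u y"
    using orthogonal_to_vector_exists[of u] by auto
  define v where "v = y /\<^sub>R norm y"
  have v: "norm v = 1" "u \<bullet> v = 0" using y by (simp_all add: v_def orthogonal_def)
  define w where "w = u \<times> v"
  have exp: "x = (u \<bullet> x) *\<^sub>R u + (v \<bullet> x) *\<^sub>R v + (w \<bullet> x) *\<^sub>R w" for x
    unfolding w_def by (rule orthonormal_expansion[OF u v])
  define \<alpha> \<beta> where "\<alpha> = v \<bullet> (A *v v)" and "\<beta> = w \<bullet> (A *v v)"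
  have "u \<bullet> (A *v v) = 0" using inn[of u v] Au v by simp
  then have Av: "A *v v = \<alpha> *\<^sub>R v + \<beta> *\<^sub>R w"
    using exp[of "A *v v"] by (simp add: \<alpha>_def \<beta>_def)
  have uw: "u \<times> w = - v"
    using Lagrange[of u u v] u v by (simp add: w_def norm_eq_1)
  \<comment> \<open>A rotation matrix preserves the cross product, so the image of
    \<open>w = u \<times> v\<close> follows from those of \<open>u\<close> and
    \<open>v\<close>.\<close>
  have Aw: "A *v w = \<alpha> *\<^sub>R w - \<beta> *\<^sub>R v"
    using cross_rotation_matrix[OF assms, of u v] Au Av uw
    by (simp add: w_def cross_add_right cross_mult_right)
  have ip: "u \<bullet> u = 1" "v \<bullet> v = 1" "w \<bullet> w = 1" "u \<bullet> v = 0" "u \<bullet> w = 0" "v \<bullet> w = 0"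
    using u v by (simp_all add: norm_eq_1 w_def dot_cross_self dot_cross inner_commute)
  have "\<alpha>\<^sup>2 + \<beta>\<^sup>2 = 1"
    using inn[of v v] ip by (simp add: Av inner_add_left inner_add_right inner_commute power2_eq_square)
  \<comment> \<open>Both signs of the axis at once: the term along the axis is even in
    \<open>u'\<close>, and only the sine term sees the sign.\<close>
  have fin: "A *v x = rot u' \<phi> x" if "\<alpha> = cos \<phi>" "sin \<phi> *\<^sub>R u' = \<beta> *\<^sub>R u" "u' = u \<or> u' = - u" for x u' \<phi>
  proof -
    have "A *v x = (u \<bullet> x) *\<^sub>R u + (v \<bullet> x) *\<^sub>R (\<alpha> *\<^sub>R v + \<beta> *\<^sub>R w) + (w \<bullet> x) *\<^sub>R (\<alpha> *\<^sub>R w - \<beta> *\<^sub>R v)"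
      by (subst exp[of x]) (simp only: matrix_vector_right_distrib matrix_vector_mult_scaleR Au Av Aw)
    also have "\<dots> = \<alpha> *\<^sub>R ((u \<bullet> x) *\<^sub>R u + (v \<bullet> x) *\<^sub>R v + (w \<bullet> x) *\<^sub>R w)
        + \<beta> *\<^sub>R ((v \<bullet> x) *\<^sub>R w - (w \<bullet> x) *\<^sub>R v) + ((1 - \<alpha>) * (u \<bullet> x)) *\<^sub>R u"
      by (simp add: algebra_simps)
    also have "(u \<bullet> x) *\<^sub>R u + (v \<bullet> x) *\<^sub>R v + (w \<bullet> x) *\<^sub>R w = x" by (simp flip: exp)
    also have "(v \<bullet> x) *\<^sub>R w - (w \<bullet> x) *\<^sub>R v = u \<times> x"
      by (subst (3) exp[of x]) (simp add: cross_add_right cross_mult_right uw w_def[symmetric])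
    also have "\<beta> *\<^sub>R (u \<times> x) = sin \<phi> *\<^sub>R (u' \<times> x)"
      by (metis cross_mult_left that(2))
    finally show ?thesis using that by (auto simp: rot_def)
  qed
  show thesis
  proof (cases "\<beta> \<ge> 0")
    case True
    obtain \<phi> where "0 \<le> \<phi>" "\<phi> \<le> pi" "\<alpha> = cos \<phi>" "\<beta> = sin \<phi>"
      using sincos_total_pi[OF True \<open>\<alpha>\<^sup>2 + \<beta>\<^sup>2 = 1\<close>] by auto
    then show thesis using that[of u \<phi>] u fin[of \<phi> u] by simp
  next
    case False
    obtain \<phi> where "0 \<le> \<phi>" "\<phi> \<le> pi" "\<alpha> = cos \<phi>" "- \<beta> = sin \<phi>"
      using sincos_total_pi[of "- \<beta>" \<alpha>] False \<open>\<alpha>\<^sup>2 + \<beta>\<^sup>2 = 1\<close> by auto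
    then have "sin \<phi> *\<^sub>R (- u) = \<beta> *\<^sub>R u" by (simp flip: \<open>- \<beta> = sin \<phi>\<close>)
    then show thesis using that[of "- u" \<phi>] u fin[of \<phi> "- u"] \<open>0 \<le> \<phi>\<close> \<open>\<phi> \<le> pi\<close> \<open>\<alpha> = cos \<phi>\<close> by simp
  qed
qed

subsection \<open>Coplanarity of face diagonals\<close>

text \<open>The vectors rotated by \<open>-h\<close> and \<open>h\<close> have a common even part
  \<open>S\<close> and opposite odd parts. Only the mixed product \<open>S \<times> r\<close>
  survives, and \<open>Lagrange\<close> evaluates it.\<close>

lemma cross_rot_half_same:
  fixes u p :: "real^3"
  assumes "norm u = 1"
  shows "rot u (- h) p \<times> rot u h p =
    (2 * sin h) *\<^sub>R ((cos h * (p \<bullet> p) + (1 - cos h) * (u \<bullet> p)\<^sup>2) *\<^sub>R u - (u \<bullet> p) *\<^sub>R p)"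
proof -
  define r S where "r = u \<times> p" and "S = cos h *\<^sub>R p + ((1 - cos h) * (u \<bullet> p)) *\<^sub>R u"
  have pm: "rot u (- h) p = S - sin h *\<^sub>R r" "rot u h p = S + sin h *\<^sub>R r"
    by (simp_all add: rot_def r_def S_def)
  have "u \<bullet> u = 1" using assms by (simp add: norm_eq_1)
  have "(S - sin h *\<^sub>R r) \<times> (S + sin h *\<^sub>R r) = (2 * sin h) *\<^sub>R (S \<times> r)"
    using cross_skew[of r S]
    by (simp add: Cross3.left_diff_distrib Cross3.right_diff_distrib cross_add_left cross_add_right cross_mult_left cross_mult_right
        flip: scaleR_add_left)
  also have "S \<times> r = (cos h * (p \<bullet> p) + (1 - cos h) * (u \<bullet> p)\<^sup>2) *\<^sub>R u - (u \<bullet> p) *\<^sub>R p"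
    using \<open>u \<bullet> u = 1\<close>
    by (simp add: S_def r_def cross_add_left cross_mult_left Lagrange inner_commute power2_eq_square algebra_simps)
  finally show ?thesis by (simp add: pm)
qed

text \<open>In the same even-odd splitting, antisymmetrizing in \<open>p\<close> and
  \<open>q\<close> cancels the mixed products. What remains are two products that depend on
  \<open>p\<close> and \<open>q\<close> only through \<open>q \<times> p\<close>.\<close>

lemma cross_rot_half_skew:
  fixes u p q :: "real^3"
  assumes "norm u = 1"
  shows "rot u (- h) q \<times> rot u h p - rot u (- h) p \<times> rot u h q =
    2 *\<^sub>R (cos h *\<^sub>R (q \<times> p) + ((2 * (cos h)\<^sup>2 - 1 - cos h) * (u \<bullet> (q \<times> p))) *\<^sub>R u)"
proof -
  have "u \<bullet> u = 1" using assms by (simp add: norm_eq_1)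
  define n where "n = q \<times> p"
  define S where "S x = cos h *\<^sub>R x + ((1 - cos h) * (u \<bullet> x)) *\<^sub>R u" for x
  have pm: "rot u (- h) x = S x - sin h *\<^sub>R (u \<times> x)" "rot u h x = S x + sin h *\<^sub>R (u \<times> x)" for x
    by (simp_all add: rot_def S_def)
  \<comment> \<open>This combination is the component of \<open>n\<close> orthogonal to
    \<open>u\<close>, obtained as a double cross product with \<open>u\<close>.\<close>
  have "(u \<bullet> p) *\<^sub>R (q \<times> u) + (u \<bullet> q) *\<^sub>R (u \<times> p) = - (u \<times> (u \<times> n))"
    using cross_skew[of q u]
    by (simp add: n_def Lagrange[of u q p] Cross3.right_diff_distrib cross_mult_right)
  also have "\<dots> = n - (u \<bullet> n) *\<^sub>R u" by (simp add: Lagrange[of u u n] \<open>u \<bullet> u = 1\<close>)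
  finally have n2: "(u \<bullet> p) *\<^sub>R (q \<times> u) + (u \<bullet> q) *\<^sub>R (u \<times> p) = n - (u \<bullet> n) *\<^sub>R u" .
  have SS: "S q \<times> S p = (cos h)\<^sup>2 *\<^sub>R n + (cos h * (1 - cos h)) *\<^sub>R (n - (u \<bullet> n) *\<^sub>R u)"
    unfolding n2[symmetric]
    by (simp add: S_def n_def cross_add_left cross_add_right cross_mult_left cross_mult_right
        Cross3.left_diff_distrib Cross3.right_diff_distrib algebra_simps power2_eq_square)
  have uu: "(u \<times> q) \<times> (u \<times> p) = (u \<bullet> n) *\<^sub>R u"
    using Lagrange[of "u \<times> q" u p] cross_triple[of u q p]
    by (simp add: n_def dot_cross_self inner_commute)
  \<comment> \<open>Translates the componentwise product with the numeral 2 in \<open>real^3\<close>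
    into scaling.\<close>
  have two: "2 * v = 2 *\<^sub>R v" "v * 2 = 2 *\<^sub>R v" for v :: "real^3" by (simp_all add: vec_eq_iff)
  have "rot u (- h) q \<times> rot u h p - rot u (- h) p \<times> rot u h q
      = 2 *\<^sub>R (S q \<times> S p - (sin h)\<^sup>2 *\<^sub>R ((u \<times> q) \<times> (u \<times> p)))"
    unfolding pm
    using cross_skew[of "S p" "S q"] cross_skew[of "u \<times> p" "u \<times> q"]
      cross_skew[of "u \<times> q" "S p"] cross_skew[of "u \<times> p" "S q"]
    by (simp add: Cross3.left_diff_distrib Cross3.right_diff_distrib cross_add_left cross_add_right
        cross_mult_left cross_mult_right power2_eq_square two algebra_simps)
  also have "\<dots> = 2 *\<^sub>R (cos h *\<^sub>R n + ((2 * (cos h)\<^sup>2 - 1 - cos h) * (u \<bullet> n)) *\<^sub>R u)"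
    unfolding SS uu sin_squared_eq by (simp add: two algebra_simps power2_eq_square)
  finally show ?thesis by (simp add: n_def)
qed

text \<open>Passing to the opposite face replaces \<^term>\<open>q\<close> by \<^term>\<open>- q\<close> (and the centre \<^term>\<open>m\<close> by \<^term>\<open>- m\<close>). The normal vector of a pair of diagonals
  splits into a part that is even in \<^term>\<open>q\<close> and a part that is odd.\<close>

definition diff_part :: "real^3 \<Rightarrow> real \<Rightarrow> real^3 \<Rightarrow> real^3 \<Rightarrow> real^3" where
  "diff_part u h p q = (2 * sin h) *\<^sub>R
     ((cos h * (p \<bullet> p - q \<bullet> q) + (1 - cos h) * ((u \<bullet> p)\<^sup>2 - (u \<bullet> q)\<^sup>2)) *\<^sub>R u
      - (u \<bullet> p) *\<^sub>R p + (u \<bullet> q) *\<^sub>R q)"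

definition skew_part :: "real^3 \<Rightarrow> real \<Rightarrow> real^3 \<Rightarrow> real^3 \<Rightarrow> real^3" where
  "skew_part u h p q =
    2 *\<^sub>R (cos h *\<^sub>R (q \<times> p) + ((2 * (cos h)\<^sup>2 - 1 - cos h) * (u \<bullet> (q \<times> p))) *\<^sub>R u)"

lemma cross_rot_half_sum:
  assumes "norm u = 1"
  shows "rot u (- h) (p + q) \<times> rot u h (p - q) = diff_part u h p q + skew_part u h p q"
proof -
  have "rot u (- h) (p + q) \<times> rot u h (p - q) =
     (rot u (- h) p \<times> rot u h p - rot u (- h) q \<times> rot u h q)
      + (rot u (- h) q \<times> rot u h p - rot u (- h) p \<times> rot u h q)"
    by (simp add: linear_add[OF linear_rot] linear_diff[OF linear_rot] cross_add_left
        Cross3.right_diff_distrib)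
  also have "rot u (- h) p \<times> rot u h p - rot u (- h) q \<times> rot u h q = diff_part u h p q"
    unfolding cross_rot_half_same[OF assms] diff_part_def by (simp add: algebra_simps)
  finally show ?thesis unfolding cross_rot_half_skew[OF assms] skew_part_def .
qed

lemma parts_uminus: "diff_part u h p (- q) = diff_part u h p q" "skew_part u h p (- q) = - skew_part u h p q"
  by (simp_all add: diff_part_def skew_part_def algebra_simps)

text \<open>In the application \<open>m\<close> is the centre of a face and \<open>p\<close>,
  \<open>q\<close> are its half edges, so \<open>p + q\<close> and \<open>p - q\<close> are its half
  diagonals. The common normal of the diagonals and the displacement of the centre are both images
  under \<open>rot u (\<phi>/2)\<close>; since rotations preserve inner products, everything can be
  computed in the half-way frame.\<close>

lemma coplanar_face_iff:
  fixes \<phi> t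
  assumes u: "norm u = 1"
  defines "\<Phi> \<equiv> \<lambda>x. rot u \<phi> x + rot u (\<phi>/2) t"
  shows "coplanar {m + p + q, m - p - q, \<Phi> (m + p - q), \<Phi> (m - p + q)} \<longleftrightarrow>
    (diff_part u (\<phi>/2) p q + skew_part u (\<phi>/2) p q) \<bullet> (t + (2 * sin (\<phi>/2)) *\<^sub>R (u \<times> m)) = 0"
proof -
  define h where "h = \<phi> / 2"
  define f g where "f = p + q" and "g = p - q"
  define z where "z = rot u \<phi> m + rot u h t - m"
  have BB: "rot u h (rot u h x) = rot u \<phi> x" "rot u h (rot u (- h) x) = x" for x
    by (simp_all add: rot_add[OF u] h_def)
  have \<Phi>: "\<Phi> (m + p - q) - (m + p + q) = z - f + rot u \<phi> g"
    "\<Phi> (m - p + q) - (m + p + q) = z - f - rot u \<phi> g"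
    by (simp_all add: \<Phi>_def z_def f_def g_def h_def linear_add[OF linear_rot] linear_diff[OF linear_rot])
  have sq: "(a + b) \<times> (a - b) = (-2) *\<^sub>R (a \<times> b)" for a b :: "real^3"
    using cross_skew[of b a] by (simp add: Cross3.right_diff_distrib cross_add_left scaleR_2)
  have "coplanar {m + p + q, m - p - q, \<Phi> (m + p - q), \<Phi> (m - p + q)} \<longleftrightarrow>
      ((-2) *\<^sub>R f) \<bullet> ((z - f + rot u \<phi> g) \<times> (z - f - rot u \<phi> g)) = 0"
    unfolding coplanar_4_iff_triple_product \<Phi> by (simp add: f_def scaleR_2 algebra_simps)
  also have "(z - f + rot u \<phi> g) \<times> (z - f - rot u \<phi> g) = (-2) *\<^sub>R ((z - f) \<times> rot u \<phi> g)"
    using sq[of "z - f" "rot u \<phi> g"] .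
  also have "((-2) *\<^sub>R f) \<bullet> ((-2) *\<^sub>R ((z - f) \<times> rot u \<phi> g)) = - 4 * ((f \<times> rot u \<phi> g) \<bullet> z)"
    using cross_triple[of f "rot u \<phi> g" z] cross_skew[of z "rot u \<phi> g"]
    by (simp add: Cross3.left_diff_distrib inner_diff_right dot_cross_self inner_commute)
  also have "f \<times> rot u \<phi> g = rot u h (rot u (- h) f \<times> rot u h g)"
    by (simp add: BB flip: cross_rot[OF u])
  also have "z = rot u h (rot u h m - rot u (- h) m + t)"
    by (simp add: linear_add[OF linear_rot] linear_diff[OF linear_rot] BB z_def)
  also have "rot u h m - rot u (- h) m = (2 * sin h) *\<^sub>R (u \<times> m)"
    by (simp add: rot_def flip: scaleR_add_left)
  also have "rot u (- h) f \<times> rot u h g = diff_part u h p q + skew_part u h p q"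
    unfolding f_def g_def by (rule cross_rot_half_sum[OF u])
  finally show ?thesis by (simp add: inner_rot[OF u] h_def add.commute)
qed

text \<open>The opposite face flips the signs of \<open>skew_part\<close> and of
  \<open>u \<times> m\<close>. The sum and the difference of the two conditions separate the even
  from the odd terms, and the assumption on \<open>m\<close> removes one term of the sum.\<close>

lemma coplanar_opposite_faces_iff:
  assumes u: "norm u = 1" and m: "skew_part u (\<phi>/2) p q \<bullet> (u \<times> m) = 0"
    and \<Phi>: "\<Phi> = (\<lambda>x. rot u \<phi> x + rot u (\<phi>/2) t)"
  shows "coplanar {m + p + q, m - p - q, \<Phi> (m + p - q), \<Phi> (m - p + q)} \<and>
    coplanar {- m + p - q, - m - p + q, \<Phi> (- m + p + q), \<Phi> (- m - p - q)} \<longleftrightarrow>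
    diff_part u (\<phi>/2) p q \<bullet> t = 0 \<and>
    skew_part u (\<phi>/2) p q \<bullet> t + 2 * sin (\<phi>/2) * (diff_part u (\<phi>/2) p q \<bullet> (u \<times> m)) = 0"
proof -
  have "coplanar {- m + p - q, - m - p + q, \<Phi> (- m + p + q), \<Phi> (- m - p - q)} \<longleftrightarrow> 
   (diff_part u (\<phi>/2) p q - skew_part u (\<phi>/2) p q) \<bullet> (t - (2 * sin (\<phi>/2)) *\<^sub>R (u \<times> m)) = 0"
    using coplanar_face_iff[OF u, of "- m" p "- q" \<phi> t] by (simp add: \<Phi> parts_uminus)
  moreover have "coplanar {m + p + q, m - p - q, \<Phi> (m + p - q), \<Phi> (m - p + q)} \<longleftrightarrow>
    (diff_part u (\<phi>/2) p q + skew_part u (\<phi>/2) p q) \<bullet> (t + (2 * sin (\<phi>/2)) *\<^sub>R (u \<times> m)) = 0"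
    unfolding \<Phi> by (rule coplanar_face_iff[OF u])
  ultimately show ?thesis
    using m by (auto simp: inner_add_left inner_add_right inner_diff_left inner_diff_right)
qed

section \<open>Scalar equations from the three pairs of opposite faces\<close>

lemma admitted_iff_faces:
  fixes d :: "real^3"
  assumes \<Phi>: "motion \<Phi>"
  defines "f \<equiv> \<lambda>i j k l. coplanar {vert d i, vert d j, \<Phi> (- vert d k), \<Phi> (- vert d l)}"
  shows "admitted d \<Phi> \<longleftrightarrow> (f 4 1 3 2 \<and> f 2 3 1 4) \<and> (f 4 2 1 3 \<and> f 3 1 2 4) \<and> (f 4 3 2 1 \<and> f 1 2 3 4)"
proof -
  \<comment> \<open>Symmetry within each edge reduces the 24 permutations to six conditions, one per
    face of the parallelepiped, grouped by opposite faces.\<close>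
  have sym: "f j i k l = f i j k l" "f i j l k = f i j k l" for i j k l
    by (simp_all add: f_def insert_commute)
  have "admitted d \<Phi> \<longleftrightarrow> (\<forall>i j k l. distinct [i, j, k, l] \<longrightarrow> f i j k l)"
    using \<Phi> by (simp add: admitted_def f_def)
  also have "\<dots> \<longleftrightarrow> (f 4 1 3 2 \<and> f 2 3 1 4) \<and> (f 4 2 1 3 \<and> f 3 1 2 4) \<and> (f 4 3 2 1 \<and> f 1 2 3 4)"
    unfolding forall_4 
    using sym by simp metis
  finally show ?thesis .
qed

lemma motion_rot: "norm u = 1 \<Longrightarrow> motion (\<lambda>x. rot u \<phi> x + b)"
  unfolding motion_def using rotation_matrix_rot[of u \<phi>] rot_eq_matrix[of u \<phi>] by metis

lemma vert_expand:
  fixes d :: "real^3"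
  defines "a \<equiv> d$1 *\<^sub>R ebasis 1" and "b \<equiv> d$2 *\<^sub>R ebasis 2" and "c \<equiv> d$3 *\<^sub>R ebasis 3"
  shows "vert d 1 = a - b - c" "vert d 2 = b - c - a" "vert d 3 = c - a - b" "vert d 4 = a + b + c"
  by (simp_all add: vert_def a_def b_def c_def axis_def vec_eq_iff forall_3)

text \<open>For each coordinate direction the face centre and the two half edges are the three edge
  vectors in cyclic order. \<open>X\<close> comes from the sums and \<open>Y\<close> from the
  differences over opposite faces, up to the factors 2 and -2.\<close>

lemma admitted_iff_equations:
  fixes d u t :: "real^3" and \<phi> :: real
  assumes u: "norm u = 1"
  defines "c \<equiv> cos (\<phi>/2)" and "s \<equiv> sin (\<phi>/2)" and "w \<equiv> u \<bullet> t"
  defines "X \<equiv> \<lambda>j k. s * ((c * ((d$j)\<^sup>2 - (d$k)\<^sup>2) + (1 - c) * ((u$j)\<^sup>2 * (d$j)\<^sup>2 - (u$k)\<^sup>2 * (d$k)\<^sup>2)) * w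
     - (d$j)\<^sup>2 * u$j * t$j + (d$k)\<^sup>2 * u$k * t$k)"
  defines "Y \<equiv> \<lambda>i j k. d$j * d$k * (c * t$i + (2 * c\<^sup>2 - 1 - c) * u$i * w)
     + 2 * s\<^sup>2 * d$i * ((d$j)\<^sup>2 + (d$k)\<^sup>2) * u$j * u$k"
  shows "admitted d (\<lambda>x. rot u \<phi> x + rot u (\<phi>/2) t) \<longleftrightarrow>
    X 2 3 = 0 \<and> X 3 1 = 0 \<and> X 1 2 = 0 \<and> Y 1 2 3 = 0 \<and> Y 2 3 1 = 0 \<and> Y 3 1 2 = 0"
proof -
  define e1 e2 e3 where "e1 = d$1 *\<^sub>R ebasis 1" and "e2 = d$2 *\<^sub>R ebasis 2" and "e3 = d$3 *\<^sub>R ebasis 3"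
  note e = e1_def e2_def e3_def
  have comp: "e1$1 = d$1" "e1$2 = 0" "e1$3 = 0" "e2$1 = 0" "e2$2 = d$2" "e2$3 = 0" "e3$1 = 0" "e3$2 = 0" "e3$3 = d$3"
    by (simp_all add: e axis_def)
  define \<Phi> where "\<Phi> = (\<lambda>x. rot u \<phi> x + rot u (\<phi>/2) t)"
  \<comment> \<open>\<open>skew_part\<close> is a combination of \<open>u\<close> and the cross
    product of two edges. The latter is parallel to the third edge \<open>m\<close>, so both are
    orthogonal to \<open>u \<times> m\<close>.\<close>
  have skew0: "skew_part u (\<phi>/2) e2 e3 \<bullet> (u \<times> e1) = 0" "skew_part u (\<phi>/2) e3 e1 \<bullet> (u \<times> e2) = 0"
    "skew_part u (\<phi>/2) e1 e2 \<bullet> (u \<times> e3) = 0"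
    by (simp_all add: skew_part_def inner_vec_def sum_3 cross_components comp)
  note F = coplanar_opposite_faces_iff[OF u skew0(1) \<Phi>_def]
     coplanar_opposite_faces_iff[OF u skew0(2) \<Phi>_def]
     coplanar_opposite_faces_iff[OF u skew0(3) \<Phi>_def]
  have X: "diff_part u (\<phi>/2) e2 e3 \<bullet> t = 2 * X 2 3" "diff_part u (\<phi>/2) e3 e1 \<bullet> t = 2 * X 3 1"
    "diff_part u (\<phi>/2) e1 e2 \<bullet> t = 2 * X 1 2"
    unfolding X_def c_def s_def w_def diff_part_def inner_vec_def sum_3
    by (simp_all add: comp power2_eq_square algebra_simps)
  have Y: "skew_part u (\<phi>/2) e2 e3 \<bullet> t + 2 * sin (\<phi>/2) * (diff_part u (\<phi>/2) e2 e3 \<bullet> (u \<times> e1)) = - 2 * Y 1 2 3"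
    "skew_part u (\<phi>/2) e3 e1 \<bullet> t + 2 * sin (\<phi>/2) * (diff_part u (\<phi>/2) e3 e1 \<bullet> (u \<times> e2)) = - 2 * Y 2 3 1"
    "skew_part u (\<phi>/2) e1 e2 \<bullet> t + 2 * sin (\<phi>/2) * (diff_part u (\<phi>/2) e1 e2 \<bullet> (u \<times> e3)) = - 2 * Y 3 1 2"
    unfolding Y_def c_def s_def w_def diff_part_def skew_part_def inner_vec_def sum_3
    by (simp_all add: cross_components comp power2_eq_square algebra_simps)
  have V: "e1 + e2 + e3 = vert d 4" "e1 - e2 - e3 = vert d 1" "e1 + e2 - e3 = - vert d 3" "e1 - e2 + e3 = - vert d 2"
    "- e1 + e2 - e3 = vert d 2" "- e1 - e2 + e3 = vert d 3" "- e1 + e2 + e3 = - vert d 1" "- e1 - e2 - e3 = - vert d 4"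
    "e2 + e3 + e1 = vert d 4" "e2 - e3 - e1 = vert d 2" "e2 + e3 - e1 = - vert d 1" "e2 - e3 + e1 = - vert d 3"
    "- e2 + e3 - e1 = vert d 3" "- e2 - e3 + e1 = vert d 1" "- e2 + e3 + e1 = - vert d 2" "- e2 - e3 - e1 = - vert d 4"
    "e3 + e1 + e2 = vert d 4" "e3 - e1 - e2 = vert d 3" "e3 + e1 - e2 = - vert d 2" "e3 - e1 + e2 = - vert d 1"
    "- e3 + e1 - e2 = vert d 1" "- e3 - e1 + e2 = vert d 2" "- e3 + e1 + e2 = - vert d 3" "- e3 - e1 - e2 = - vert d 4"
    by (simp_all add: vert_expand[of d, folded e])
  have "motion \<Phi>" unfolding \<Phi>_def by (rule motion_rot[OF u])
  from admitted_iff_faces[OF this, of d]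
  show ?thesis
    unfolding F[unfolded V] X Y unfolding \<Phi>_def by auto
qed

subsection \<open>The equations of an admitted motion\<close>

definition Dsum :: "real^3 \<Rightarrow> real" where
  "Dsum d = Dinv d 1 + Dinv d 2 + Dinv d 3"

text \<open>One eighth of the volume of the parallelepiped.\<close>

definition vol :: "real^3 \<Rightarrow> real" where
  "vol d = d$1 * d$2 * d$3"

lemma distinct_3_cases:
  fixes i j k :: 3
  assumes "distinct [i, j, k]"
  obtains "i = 1" "j = 2" "k = 3" | "i = 2" "j = 3" "k = 1" | "i = 3" "j = 1" "k = 2"
    | "i = 1" "j = 3" "k = 2" | "i = 2" "j = 1" "k = 3" | "i = 3" "j = 2" "k = 1"
  using assms exhaust_3[of i] exhaust_3[of j] exhaust_3[of k] by auto

lemma ex_distinct_3: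
  fixes k :: 3
  obtains i j where "distinct [i, j, k]"
proof -
  have "distinct [2, 3, 1 :: 3]" "distinct [1, 3, 2 :: 3]" "distinct [1, 2, 3 :: 3]" by simp_all
  then show thesis using that exhaust_3[of k] by metis
qed

lemma distinct_3_exhaust:
  fixes i j k m :: 3
  assumes "distinct [i, j, k]"
  shows "m = i \<or> m = j \<or> m = k"
  using assms by (rule distinct_3_cases) (use exhaust_3[of m] in auto)

lemma sum_distinct_3:
  fixes f :: "3 \<Rightarrow> real"
  assumes "distinct [i, j, k]"
  shows "f 1 + f 2 + f 3 = f i + f j + f k"
  using assms by (rule distinct_3_cases) auto

lemma prod_distinct_3:
  fixes f :: "3 \<Rightarrow> real"
  assumes "distinct [i, j, k]"
  shows "f 1 * f 2 * f 3 = f i * f j * f k"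
  using assms by (rule distinct_3_cases) auto

text \<open>The three equations say that \<open>a i * (c * w + (1 - c) * (u i)\<^sup>2 * w - u i * t i)\<close> does not depend on \<open>i\<close>;
  its value \<open>2 * c * w / S\<close> comes out by adding up the three expressions with weights \<open>D i\<close>.\<close>

lemma cyclic_equations_iff:
  fixes a D u t :: "3 \<Rightarrow> real" and c w :: real
  assumes aD: "\<And>i. a i * D i = 1" and u: "(u 1)\<^sup>2 + (u 2)\<^sup>2 + (u 3)\<^sup>2 = 1"
    and S: "S = D 1 + D 2 + D 3" "S \<noteq> 0" and w: "w = u 1 * t 1 + u 2 * t 2 + u 3 * t 3"
  defines "X \<equiv> \<lambda>j k. (c * (a j - a k) + (1 - c) * ((u j)\<^sup>2 * a j - (u k)\<^sup>2 * a k)) * w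
     - a j * u j * t j + a k * u k * t k = 0"
  shows "X 2 3 \<and> X 3 1 \<and> X 1 2 \<longleftrightarrow> (\<forall>i. u i * t i = w * (c + (1 - c) * (u i)\<^sup>2 - 2 * c * D i / S))"
proof -
  define g where "g i = a i * (c * w + (1 - c) * (u i)\<^sup>2 * w - u i * t i)" for i
  have X: "X j k \<longleftrightarrow> g j = g k" for j k
    by (simp add: X_def g_def algebra_simps)
  have gD: "D i * g i = c * w + (1 - c) * (u i)\<^sup>2 * w - u i * t i" for i
    unfolding g_def using aD[of i] by (metis mult.assoc mult.commute mult_1)
  have gi: "g i = y \<longleftrightarrow> c * w + (1 - c) * (u i)\<^sup>2 * w - u i * t i = D i * y" for i y
    using gD[of i] aD[of i] by (metis mult_cancel_left mult_zero_right zero_neq_one)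
  have "X 2 3 \<and> X 3 1 \<and> X 1 2 \<longleftrightarrow> (\<forall>i. g i = 2 * c * w / S)"
  proof
    assume "X 2 3 \<and> X 3 1 \<and> X 1 2"
    then have g31: "g 2 = g 3" "g 3 = g 1" unfolding X by blast+
    then have g12: "g 2 = g 1" "g 3 = g 1" by (blast intro: trans)+
    then have g: "g i = g 1" for i using exhaust_3[of i] by auto
    have "S * g 1 = D 1 * g 1 + D 2 * g 2 + D 3 * g 3"
      unfolding S(1) g12 by (simp add: distrib_right)
    also have "\<dots> = 3 * c * w + (1 - c) * ((u 1)\<^sup>2 + (u 2)\<^sup>2 + (u 3)\<^sup>2) * w - (u 1 * t 1 + u 2 * t 2 + u 3 * t 3)"
      unfolding gD by (simp add: algebra_simps)
    also have "\<dots> = 2 * c * w" unfolding u w[symmetric] by (simp add: algebra_simps)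
    finally have "g 1 = 2 * c * w / S" using S(2) by (simp add: eq_divide_eq mult.commute)
    then show "\<forall>i. g i = 2 * c * w / S" using g by simp
  next
    assume g: "\<forall>i. g i = 2 * c * w / S"
    then show "X 2 3 \<and> X 3 1 \<and> X 1 2" unfolding X by simp
  qed
  also have "\<dots> \<longleftrightarrow> (\<forall>i. u i * t i = w * (c + (1 - c) * (u i)\<^sup>2 - 2 * c * D i / S))"
    unfolding gi by (intro all_cong1) (simp add: algebra_simps, linarith)
  finally show ?thesis .
qed

lemma third_num_eq: "third_num s = (s\<^sup>2 + 1)\<^sup>2" and third_den_eq: "third_den s = (s\<^sup>2 + 1) * (3 * s\<^sup>2 + 1)"
  unfolding third_num_def third_den_def by algebra+

text \<open>With \<open>q\<close> the squared sine, \<open>(cot h)\<^sup>2 + 1\<close> is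
  \<open>1 / q\<close> and \<open>3 * (cot h)\<^sup>2 + 1\<close> is \<open>(3 - 2 * q) / q\<close>.
  The rational formula for a squared axis coordinate thereby takes the form in which it arises from
  the coplanarity equations.\<close>

lemma third_coordinate_iff:
  fixes h D S y :: real
  assumes "sin h \<noteq> 0" "S \<noteq> 0"
  shows "y = (third_num (cot h) - third_den (cot h) * (D / S)) / (2 * ((cot h)\<^sup>2 + 1)) \<longleftrightarrow>
    2 * (sin h)\<^sup>2 * S * y = S - (2 * (cos h)\<^sup>2 + 1) * D"
proof -
  define q where "q = (sin h)\<^sup>2"
  have q: "q \<noteq> 0" "(cos h)\<^sup>2 = 1 - q" using assms by (simp_all add: q_def cos_squared_eq)
  have cot: "(cot h)\<^sup>2 = (1 - q) / q" using q by (simp add: cot_def power_divide flip: q_def)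
  have "third_num (cot h) = (1 / q)\<^sup>2" "third_den (cot h) = 1 / q * ((3 - 2 * q) / q)"
    unfolding third_num_eq third_den_eq cot using q(1) by (simp_all add: field_simps)
  moreover have "(cot h)\<^sup>2 + 1 = 1 / q" unfolding cot using q(1) by (simp add: field_simps)
  ultimately have "(third_num (cot h) - third_den (cot h) * (D / S)) / (2 * ((cot h)\<^sup>2 + 1)) =
     ((1 / q)\<^sup>2 - 1 / q * ((3 - 2 * q) / q) * (D / S)) / (2 * (1 / q))" by simp
  also have "\<dots> = (S - (3 - 2 * q) * D) / (2 * q * S)"
    using q(1) assms(2) by (simp add: field_simps power2_eq_square)
  finally have eq: "(third_num (cot h) - third_den (cot h) * (D / S)) / (2 * ((cot h)\<^sup>2 + 1)) =
    (S - (3 - 2 * q) * D) / (2 * q * S)" .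
  show ?thesis unfolding eq q(2) q_def[symmetric]
    using q(1) assms(2) by (auto simp: field_simps)
qed

locale parallelepiped =
  fixes d :: "real^3"
  assumes d_pos: "d$i > 0"
begin

lemma Dinv_pos: "Dinv d i > 0"
  using d_pos[of i] by (simp add: Dinv_def)

lemma Dsum_pos: "Dsum d > 0"
  using Dinv_pos[of 1] Dinv_pos[of 2] Dinv_pos[of 3] by (simp add: Dsum_def)

lemma Dsum_distinct: "distinct [i, j, k] \<Longrightarrow> Dsum d = Dinv d i + Dinv d j + Dinv d k"
  unfolding Dsum_def by (rule sum_distinct_3)

lemma Dsum_minus_Dinv_pos: "Dsum d - Dinv d i > 0"
proof -
  obtain j k where "distinct [j, k, i]" by (rule ex_distinct_3)
  then show ?thesis using Dsum_distinct[of j k i] Dinv_pos[of j] Dinv_pos[of k] by simp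
qed

lemma vol_pos: "vol d > 0"
  using d_pos by (simp add: vol_def)

text \<open>Measuring the translation part in the half-way frame, i.e. writing it as \<^term>\<open>rot u (\<phi>/2) t\<close>, decouples
  the two families of equations.\<close>

lemma admitted_iff:
  fixes u t :: "real^3" and \<phi> :: real
  assumes u: "norm u = 1"
  defines "c \<equiv> cos (\<phi>/2)" and "s \<equiv> sin (\<phi>/2)" and "w \<equiv> u \<bullet> t"
  shows "admitted d (\<lambda>x. rot u \<phi> x + rot u (\<phi>/2) t) \<longleftrightarrow>
    (s \<noteq> 0 \<longrightarrow> (\<forall>i. u$i * t$i = w * (c + (1 - c) * (u$i)\<^sup>2 - 2 * c * Dinv d i / Dsum d))) \<and>
    (\<forall>i j k. distinct [i, j, k] \<longrightarrow>
      c * t$i + (2 * c\<^sup>2 - 1 - c) * u$i * w = - 2 * s\<^sup>2 * vol d * (Dsum d - Dinv d i) * u$j * u$k)"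
proof -
  have Y: "d$j * d$k * (c * t$i + (2 * c\<^sup>2 - 1 - c) * u$i * w)
     + 2 * s\<^sup>2 * d$i * ((d$j)\<^sup>2 + (d$k)\<^sup>2) * u$j * u$k = 0 \<longleftrightarrow>
     c * t$i + (2 * c\<^sup>2 - 1 - c) * u$i * w = - 2 * s\<^sup>2 * vol d * (Dsum d - Dinv d i) * u$j * u$k"
    if "distinct [i, j, k]" for i j k
  proof -
    \<comment> \<open>\<open>Dsum d - Dinv d i\<close> is the sum of the other two inverse squares,
      so the \<open>Y\<close> equation can be divided by \<open>d$j * d$k\<close>.\<close>
    have "d$j * d$k * (vol d * (Dsum d - Dinv d i)) = d$i * ((d$j)\<^sup>2 + (d$k)\<^sup>2)"
    proof -
      have "vol d = d$i * d$j * d$k" unfolding vol_def by (rule prod_distinct_3[OF that])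
      moreover have "Dsum d - Dinv d i = 1 / (d$j)\<^sup>2 + 1 / (d$k)\<^sup>2"
        using Dsum_distinct[OF that] by (simp add: Dinv_def)
      ultimately have *: "vol d * (Dsum d - Dinv d i) = d$i * d$j * d$k * (1 / (d$j)\<^sup>2 + 1 / (d$k)\<^sup>2)"
        by simp
      show ?thesis unfolding * using d_pos[of j] d_pos[of k]
        by (simp add: field_simps power2_eq_square)
    qed
    then have eq: "d$j * d$k * (c * t$i + (2 * c\<^sup>2 - 1 - c) * u$i * w)
     + 2 * s\<^sup>2 * d$i * ((d$j)\<^sup>2 + (d$k)\<^sup>2) * u$j * u$k =
     d$j * d$k * (c * t$i + (2 * c\<^sup>2 - 1 - c) * u$i * w + 2 * s\<^sup>2 * vol d * (Dsum d - Dinv d i) * u$j * u$k)"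
      by algebra
    have "d$j \<noteq> 0" "d$k \<noteq> 0" using d_pos[of j] d_pos[of k] by simp_all
    then show ?thesis unfolding eq mult_eq_0_iff by (auto simp: algebra_simps)
  qed
  have "(d$i)\<^sup>2 * Dinv d i = 1" for i using d_pos[of i] by (simp add: Dinv_def)
  note X = cyclic_equations_iff[of "\<lambda>i. (d$i)\<^sup>2" "Dinv d" "\<lambda>i. u$i" "Dsum d" w "\<lambda>i. t$i" c, OF this]
  have X: "(((c * ((d$2)\<^sup>2 - (d$3)\<^sup>2) + (1 - c) * ((u$2)\<^sup>2 * (d$2)\<^sup>2 - (u$3)\<^sup>2 * (d$3)\<^sup>2)) * w
        - (d$2)\<^sup>2 * u$2 * t$2 + (d$3)\<^sup>2 * u$3 * t$3 = 0) \<and>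
      ((c * ((d$3)\<^sup>2 - (d$1)\<^sup>2) + (1 - c) * ((u$3)\<^sup>2 * (d$3)\<^sup>2 - (u$1)\<^sup>2 * (d$1)\<^sup>2)) * w
        - (d$3)\<^sup>2 * u$3 * t$3 + (d$1)\<^sup>2 * u$1 * t$1 = 0) \<and>
      ((c * ((d$1)\<^sup>2 - (d$2)\<^sup>2) + (1 - c) * ((u$1)\<^sup>2 * (d$1)\<^sup>2 - (u$2)\<^sup>2 * (d$2)\<^sup>2)) * w
        - (d$1)\<^sup>2 * u$1 * t$1 + (d$2)\<^sup>2 * u$2 * t$2 = 0)) \<longleftrightarrow>
    (\<forall>i. u$i * t$i = w * (c + (1 - c) * (u$i)\<^sup>2 - 2 * c * Dinv d i / Dsum d))"
  proof (rule X)
    show "(u$1)\<^sup>2 + (u$2)\<^sup>2 + (u$3)\<^sup>2 = 1" using u by (simp add: norm_1_components)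
    show "Dsum d \<noteq> 0" using Dsum_pos by simp
  qed (simp_all add: Dsum_def w_def inner_vec_def sum_3)
  have "3 \<noteq> (1::3)" "2 \<noteq> (1::3)" "3 \<noteq> (2::3)" by simp_all
  then have dist: "distinct [1, 2, 3 :: 3]" "distinct [2, 3, 1 :: 3]" "distinct [3, 1, 2 :: 3]" by auto
  \<comment> \<open>The second family is symmetric in \<open>j\<close> and \<open>k\<close>, so the
    three cyclic permutations represent all six.\<close>
  have all: "(\<forall>i j k :: 3. distinct [i, j, k] \<longrightarrow> P i j k) \<longleftrightarrow> P 1 2 3 \<and> P 2 3 1 \<and> P 3 1 2"
    if sym: "\<And>i j k. P i j k \<longleftrightarrow> P i k j" for P
  proof
    assume P: "P 1 2 3 \<and> P 2 3 1 \<and> P 3 1 2"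
    show "\<forall>i j k :: 3. distinct [i, j, k] \<longrightarrow> P i j k"
    proof (intro allI impI)
      fix i j k :: 3 assume "distinct [i, j, k]"
      then show "P i j k"
        by (rule distinct_3_cases) (use P sym[of 1 2 3] sym[of 2 3 1] sym[of 3 1 2] in simp_all)
    qed
  qed (use dist in blast)
  \<comment> \<open>Each equation of the first family carries the factor \<open>s\<close>; this is
    the origin of the guard \<open>s \<noteq> 0\<close>.\<close>
  show ?thesis
    unfolding admitted_iff_equations[OF u] c_def[symmetric] s_def[symmetric] w_def[symmetric]
      Y[OF dist(1)] Y[OF dist(2)] Y[OF dist(3)] X[symmetric] mult_eq_0_iff[of s]
    by (subst all) (simp add: mult_ac, blast)
qed

text \<open>Multiplying the second family by \<open>u$i\<close> makes its right-hand side a multiple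
  of the product of all three coordinates. Summing over \<open>i\<close> gives the first equation;
  substituting \<open>u$i * t$i\<close> from the first family gives the second. Only the component
  \<open>w\<close> of \<open>t\<close> along the axis remains.\<close>

lemma admitted_imp_axis_equations:
  fixes u t :: "real^3" and \<phi> :: real
  assumes u: "norm u = 1" and adm: "admitted d (\<lambda>x. rot u \<phi> x + rot u (\<phi>/2) t)" and "sin (\<phi>/2) \<noteq> 0"
  defines "c \<equiv> cos (\<phi>/2)" and "s \<equiv> sin (\<phi>/2)" and "w \<equiv> u \<bullet> t"
  shows "(2 * c\<^sup>2 - 1) * w = - 4 * s\<^sup>2 * vol d * Dsum d * (u$1 * u$2 * u$3)"
    and "w * (c\<^sup>2 * (1 - 2 * Dinv d i / Dsum d) - s\<^sup>2 * (u$i)\<^sup>2) =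
      - 2 * s\<^sup>2 * vol d * (Dsum d - Dinv d i) * (u$1 * u$2 * u$3)"
proof -
  note eqs = admitted_iff[OF u, THEN iffD1, OF adm, folded c_def s_def w_def]
  have X: "u$i * t$i = w * (c + (1 - c) * (u$i)\<^sup>2 - 2 * c * Dinv d i / Dsum d)" for i
    using eqs assms(3) by (auto simp: s_def)
  have uY: "c * (u$i * t$i) + (2 * c\<^sup>2 - 1 - c) * (u$i)\<^sup>2 * w
     = - 2 * s\<^sup>2 * vol d * (Dsum d - Dinv d i) * (u$1 * u$2 * u$3)" for i
  proof -
    obtain j k where dist: "distinct [j, k, i]" by (rule ex_distinct_3)
    then have "c * t$i + (2 * c\<^sup>2 - 1 - c) * u$i * w = - 2 * s\<^sup>2 * vol d * (Dsum d - Dinv d i) * u$j * u$k"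
      using eqs[THEN conjunct2, rule_format, of i j k] by auto
    then show ?thesis unfolding prod_distinct_3[OF dist, of "\<lambda>i. u$i"] by algebra
  qed
  have "w = u$1 * t$1 + u$2 * t$2 + u$3 * t$3" by (simp add: w_def inner_vec_def sum_3)
  moreover have "(u$1)\<^sup>2 + (u$2)\<^sup>2 + (u$3)\<^sup>2 = 1" using u by (simp add: norm_1_components)
  ultimately show "(2 * c\<^sup>2 - 1) * w = - 4 * s\<^sup>2 * vol d * Dsum d * (u$1 * u$2 * u$3)"
    using uY[of 1] uY[of 2] uY[of 3] Dsum_def[of d] by algebra
  have "s\<^sup>2 + c\<^sup>2 = 1" by (simp add: s_def c_def)
  moreover define r where "r = Dinv d i / Dsum d"
  ultimately show "w * (c\<^sup>2 * (1 - 2 * Dinv d i / Dsum d) - s\<^sup>2 * (u$i)\<^sup>2) =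
      - 2 * s\<^sup>2 * vol d * (Dsum d - Dinv d i) * (u$1 * u$2 * u$3)"
    using uY[of i] unfolding X[of i] times_divide_eq_right[symmetric] r_def[symmetric] 
    by algebra
qed

section \<open>Motions of the intermediate kind\<close>

lemma inter_motion_eq: "inter_motion k u \<phi> \<tau> = (\<lambda>x. rot u \<phi> x + rot u (\<phi>/2) (\<tau> *\<^sub>R ebasis k))"
  by (simp add: inter_motion_def linear_scale[OF linear_rot])

text \<open>Here \<open>w\<close> and all products \<open>u$l * t$l\<close> vanish, and every
  right-hand side of the second family other than the one for \<open>k\<close> contains the factor
  \<open>u$k = 0\<close>. A single linear equation for \<open>\<tau>\<close> is left.\<close>

lemma inter_motion_admitted_iff:
  assumes u: "norm u = 1" and "u$k = 0" and dist: "distinct [i, j, k]"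
  shows "admitted d (inter_motion k u \<phi> \<tau>) \<longleftrightarrow>
     cos (\<phi>/2) * \<tau> = - 2 * (sin (\<phi>/2))\<^sup>2 * vol d * (Dsum d - Dinv d k) * u$i * u$j"
proof -
  have w: "u \<bullet> (\<tau> *\<^sub>R ebasis k) = 0" using \<open>u$k = 0\<close> by (simp add: inner_axis)
  have t: "(\<tau> *\<^sub>R ebasis k) $ l = (if l = k then \<tau> else 0)" for l by (simp add: axis_def)
  show ?thesis (is "_ \<longleftrightarrow> ?eq")
    unfolding inter_motion_eq admitted_iff[OF u] w t
  proof (intro iffI conjI impI allI)
    assume "(sin (\<phi> / 2) \<noteq> 0 \<longrightarrow> (\<forall>i. u$i * (if i = k then \<tau> else 0) =
         0 * (cos (\<phi> / 2) + (1 - cos (\<phi> / 2)) * (u$i)\<^sup>2 - 2 * cos (\<phi> / 2) * Dinv d i / Dsum d))) \<and>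
      (\<forall>i j k'. distinct [i, j, k'] \<longrightarrow>
       cos (\<phi> / 2) * (if i = k then \<tau> else 0) + (2 * (cos (\<phi> / 2))\<^sup>2 - 1 - cos (\<phi> / 2)) * u$i * 0 =
       - 2 * (sin (\<phi> / 2))\<^sup>2 * vol d * (Dsum d - Dinv d i) * u$j * u$k')"
    from this[THEN conjunct2, rule_format, of k i j] dist show ?eq by auto
  next
    fix a assume ?eq
    show "u$a * (if a = k then \<tau> else 0) = 0 * (cos (\<phi> / 2) + (1 - cos (\<phi> / 2)) * (u$a)\<^sup>2 - 2 * cos (\<phi> / 2) * Dinv d a / Dsum d)"
      using \<open>u$k = 0\<close> by simp
  next
    fix a b c :: 3 assume ?eq and abc: "distinct [a, b, c]"
    show "cos (\<phi> / 2) * (if a = k then \<tau> else 0) + (2 * (cos (\<phi> / 2))\<^sup>2 - 1 - cos (\<phi> / 2)) * u $ a * 0 =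
       - 2 * (sin (\<phi> / 2))\<^sup>2 * vol d * (Dsum d - Dinv d a) * u $ b * u $ c"
    proof (cases "a = k")
      case True
      then have "b = i \<and> c = j \<or> b = j \<and> c = i"
        using abc dist distinct_3_exhaust[OF dist, of b] distinct_3_exhaust[OF dist, of c] by auto
      then show ?thesis using True \<open>?eq\<close> by auto
    next
      case False
      then have "b = k \<or> c = k" using distinct_3_exhaust[OF abc, of k] by auto
      then show ?thesis using False \<open>u$k = 0\<close> by auto
    qed
  qed
qed

text \<open>The excluded angles are exactly the zeros of the leading coefficient
  \<open>cos (\<phi>/2)\<close> in the equation for \<open>\<tau>\<close>.\<close>

lemma inter_data_iff:
  "inter_data k u \<phi> \<longleftrightarrow> u$k = 0 \<and> norm u = 1 \<and> cos (\<phi>/2) \<noteq> 0"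
proof -
  have "(\<exists>i j C1 C2. distinct [i, j, k] \<and> u = C1 *\<^sub>R ebasis i + C2 *\<^sub>R ebasis j) \<longleftrightarrow> u$k = 0"
  proof
    assume "u$k = 0"
    obtain i j where ijk: "distinct [i, j, k]" by (rule ex_distinct_3)
    have "u = u$i *\<^sub>R ebasis i + u$j *\<^sub>R ebasis j"
      unfolding vec_eq_iff
    proof
      fix m
      show "u $ m = (u$i *\<^sub>R ebasis i + u$j *\<^sub>R ebasis j) $ m"
        using distinct_3_exhaust[OF ijk, of m] ijk \<open>u$k = 0\<close> by (auto simp: axis_def)
    qed
    with ijk show "\<exists>i j C1 C2. distinct [i, j, k] \<and> u = C1 *\<^sub>R ebasis i + C2 *\<^sub>R ebasis j" by blast
  qed (auto simp: axis_def)
  moreover have "(\<forall>n::int. \<phi> \<noteq> pi + of_int n * (2 * pi)) \<longleftrightarrow> cos (\<phi>/2) \<noteq> 0"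
  proof -
    have "cos (\<phi>/2) = 0 \<longleftrightarrow> (\<exists>n::int. \<phi>/2 = of_int n * pi + pi / 2)"
      by (simp add: cos_zero_iff_int2)
    also have "\<dots> \<longleftrightarrow> (\<exists>n::int. \<phi> = pi + of_int n * (2 * pi))"
      by (intro ex_cong1) (auto simp: field_simps)
    finally show ?thesis by blast
  qed
  ultimately show ?thesis unfolding inter_data_def by blast
qed

lemma inter_unique:
  assumes "inter_data k u \<phi>"
  shows "\<exists>!\<tau>. admitted d (inter_motion k u \<phi> \<tau>)"
proof -
  have u: "u$k = 0" "norm u = 1" and c: "cos (\<phi>/2) \<noteq> 0" using assms by (auto simp: inter_data_iff)
  obtain i j where "distinct [i, j, k]" by (rule ex_distinct_3)
  note iff = inter_motion_admitted_iff[OF u(2,1) this]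
  show ?thesis unfolding iff using c
    by (intro ex1I[of _ "- 2 * (sin (\<phi>/2))\<^sup>2 * vol d * (Dsum d - Dinv d k) * u$i * u$j / cos (\<phi>/2)"])
      (auto simp: field_simps)
qed

lemma inter_tau_eq:
  assumes "inter_data k u \<phi>" "admitted d (inter_motion k u \<phi> \<tau>)"
  shows "inter_tau d k u \<phi> = \<tau>"
  unfolding inter_tau_def using inter_unique[OF assms(1)] assms(2) by (rule the1_equality)

subsection \<open>Classification\<close>

lemma third_data_iff:
  "third_data d u \<phi> \<longleftrightarrow> norm u = 1 \<and> 0 < \<phi> \<and> \<phi> < 2 * pi \<and> \<phi> \<noteq> pi / 2 \<and> \<phi> \<noteq> 3 * pi / 2 \<and>
     (\<forall>i. u$i \<noteq> 0 \<and> 2 * (sin (\<phi>/2))\<^sup>2 * Dsum d * (u$i)\<^sup>2 = Dsum d - (2 * (cos (\<phi>/2))\<^sup>2 + 1) * Dinv d i)"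
proof (cases "0 < \<phi> \<and> \<phi> < 2 * pi")
  case True
  define s where "s = cot (\<phi>/2)"
  have "sin (\<phi>/2) > 0" using True by (intro sin_gt_zero) auto
  then have coord: "(u$i)\<^sup>2 = (third_num s - third_den s * (Dinv d i / Dsum d)) / (2 * (s\<^sup>2 + 1)) \<longleftrightarrow>
     2 * (sin (\<phi>/2))\<^sup>2 * Dsum d * (u$i)\<^sup>2 = Dsum d - (2 * (cos (\<phi>/2))\<^sup>2 + 1) * Dinv d i" for i
    unfolding s_def using Dsum_pos by (intro third_coordinate_iff) auto
  have s1: "s\<^sup>2 + 1 > 0" "third_den s > 0" 
    by (auto simp: third_den_eq intro!: mult_pos_pos add_nonneg_pos)
  \<comment> \<open>Given the formula for the squared coordinates, the strict inequality says that
    all of them are positive, that is, no coordinate of the axis vanishes.\<close>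
  have pos: "(third_num s / third_den s > Max (range (Dinv d)) / Dsum d) \<longleftrightarrow> (\<forall>i. u$i \<noteq> 0)"
    if *: "\<forall>i. (u$i)\<^sup>2 = (third_num s - third_den s * (Dinv d i / Dsum d)) / (2 * (s\<^sup>2 + 1))"
  proof -
    have "third_num s / third_den s > Max (range (Dinv d)) / Dsum d \<longleftrightarrow>
       Max (range (Dinv d)) < third_num s / third_den s * Dsum d"
      using Dsum_pos by (simp add: divide_less_eq)
    also have "\<dots> \<longleftrightarrow> (\<forall>i. Dinv d i < third_num s / third_den s * Dsum d)"
      by (subst Max_less_iff) auto
    also have "\<dots> \<longleftrightarrow> (\<forall>i. third_num s - third_den s * (Dinv d i / Dsum d) > 0)"
      using Dsum_pos s1 by (intro all_cong1) (simp add: field_simps)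
    also have "\<dots> \<longleftrightarrow> (\<forall>i. (u$i)\<^sup>2 > 0)"
      unfolding *[rule_format] using s1 by (intro all_cong1) (simp add: zero_less_divide_iff)
    finally show ?thesis by simp
  qed
  show ?thesis
    unfolding third_data_def Let_def s_def[symmetric] Dsum_def[symmetric]
    using pos coord by (auto simp: True)
qed (auto simp: third_data_def)

text \<open>The excluded angles make \<open>2 * c\<^sup>2 - 1\<close>, which is
  \<open>cos \<phi>\<close>, nonzero, so the axis equation fixes \<open>w\<close>. As no coordinate
  of \<open>u\<close> vanishes, the first family then fixes \<open>t\<close>. For existence, this
  \<open>t\<close> is shown to satisfy the second family.\<close>

lemma third_unique:
  assumes "third_data d u \<phi>"
  shows "\<exists>!b. admitted d (\<lambda>x. rot u \<phi> x + b)"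
proof -
  define c s where "c = cos (\<phi>/2)" and "s = sin (\<phi>/2)"
  have u: "norm u = 1" and \<phi>: "0 < \<phi>" "\<phi> < 2 * pi" "\<phi> \<noteq> pi / 2" "\<phi> \<noteq> 3 * pi / 2"
    and u0: "\<And>i. u$i \<noteq> 0" and ui: "\<And>i. 2 * s\<^sup>2 * Dsum d * (u$i)\<^sup>2 = Dsum d - (2 * c\<^sup>2 + 1) * Dinv d i"
    using assms unfolding third_data_iff c_def s_def by blast+
  have s: "s \<noteq> 0" using sin_gt_zero[of "\<phi>/2"] \<phi> by (auto simp: s_def)
  have sc: "s\<^sup>2 + c\<^sup>2 = 1" by (simp add: s_def c_def)
  have cos\<phi>: "2 * c\<^sup>2 - 1 \<noteq> 0"
  proof
    assume "2 * c\<^sup>2 - 1 = 0"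
    then have "cos \<phi> = 0" using cos_double_cos[of "\<phi>/2"] by (simp add: c_def)
    then obtain n :: int where n: "\<phi> = of_int n * pi + pi / 2" by (auto simp: cos_zero_iff_int2)
    then have "\<phi> / pi = of_int n + 1 / 2" by (simp add: field_simps)
    moreover have "0 < \<phi> / pi" "\<phi> / pi < 2" using \<phi> by (simp_all add: field_simps)
    ultimately have "n = 0 \<or> n = 1" by linarith
    then show False using n \<phi> by auto
  qed
  define U where "U = u$1 * u$2 * u$3"
  define w where "w = - 4 * s\<^sup>2 * vol d * Dsum d * U / (2 * c\<^sup>2 - 1)"
  have w: "(2 * c\<^sup>2 - 1) * w = - 4 * s\<^sup>2 * vol d * Dsum d * U" using cos\<phi> by (simp add: w_def)
  define e where "e i = w * (c + (1 - c) * (u$i)\<^sup>2 - 2 * c * Dinv d i / Dsum d)" for i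
  define t :: "real^3" where "t = (\<chi> i. e i / u$i)"
  have ut: "u$i * t$i = e i" for i using u0[of i] by (simp add: t_def)
  have uu: "(u$1)\<^sup>2 + (u$2)\<^sup>2 + (u$3)\<^sup>2 = 1" using u by (simp add: norm_1_components)
  \<comment> \<open>Consistency check: \<open>t\<close> was built from \<open>w\<close>, and its
    component along the axis must turn out to be \<open>w\<close> again.\<close>
  have "u \<bullet> t = e 1 + e 2 + e 3" by (simp add: inner_vec_def sum_3 ut)
  also have "\<dots> = w * (3 * c + (1 - c) * ((u$1)\<^sup>2 + (u$2)\<^sup>2 + (u$3)\<^sup>2) - 2 * c * (Dsum d / Dsum d))"
    unfolding e_def Dsum_def[of d] add_divide_distrib by (simp add: algebra_simps)
  also have "\<dots> = w" unfolding uu using Dsum_pos by simp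
  finally have wt: "u \<bullet> t = w" .
  have adm: "admitted d (\<lambda>x. rot u \<phi> x + rot u (\<phi>/2) t)"
    unfolding admitted_iff[OF u] wt c_def[symmetric] s_def[symmetric]
  proof (intro conjI impI allI)
    show "u$i * t$i = w * (c + (1 - c) * (u$i)\<^sup>2 - 2 * c * Dinv d i / Dsum d)" for i
      by (simp add: ut e_def)
    fix i j k :: 3 assume ijk: "distinct [i, j, k]"
    have U: "U = u$i * u$j * u$k" unfolding U_def by (rule prod_distinct_3[OF ijk])
    define r where "r = Dinv d i / Dsum d"
    have Dr: "Dinv d i = r * Dsum d" using Dsum_pos by (simp add: r_def)
    have "2 * s\<^sup>2 * (u$i)\<^sup>2 = 1 - (2 * c\<^sup>2 + 1) * r"
    proof -
      have "Dsum d * (2 * s\<^sup>2 * (u$i)\<^sup>2) = Dsum d * (1 - (2 * c\<^sup>2 + 1) * r)"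
        using ui[of i] unfolding Dr by (simp add: algebra_simps)
      then show ?thesis using Dsum_pos by simp
    qed
    \<comment> \<open>The prescribed value of \<open>(u$i)\<^sup>2\<close> makes the factor
      \<open>2 * c\<^sup>2 - 1\<close> split off, so the definition of \<open>w\<close> can be
      used.\<close>
    then have e2: "2 * (c\<^sup>2 - 2 * c\<^sup>2 * r - s\<^sup>2 * (u$i)\<^sup>2) = (2 * c\<^sup>2 - 1) * (1 - r)"
      by (simp add: algebra_simps)
    have s2: "s\<^sup>2 = 1 - c\<^sup>2" using sc by simp
    have "u$i * (c * t$i + (2 * c\<^sup>2 - 1 - c) * u$i * w) = c * (u$i * t$i) + (2 * c\<^sup>2 - 1 - c) * (u$i)\<^sup>2 * w"
      by (simp add: algebra_simps power2_eq_square)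
    also have "\<dots> = w * (c\<^sup>2 - 2 * c\<^sup>2 * r - (1 - c\<^sup>2) * (u$i)\<^sup>2)"
      unfolding ut e_def r_def by (simp add: algebra_simps power2_eq_square)
    also have "2 * \<dots> = ((2 * c\<^sup>2 - 1) * w) * (1 - r)"
      using e2 unfolding s2 by algebra
    also have "\<dots> = 2 * (- 2 * s\<^sup>2 * vol d * (Dsum d - Dinv d i) * U)"
      unfolding w Dr by (simp add: algebra_simps)
    finally have "u$i * (c * t$i + (2 * c\<^sup>2 - 1 - c) * u$i * w) = - 2 * s\<^sup>2 * vol d * (Dsum d - Dinv d i) * U"
      by linarith
    also have "\<dots> = u$i * (- 2 * s\<^sup>2 * vol d * (Dsum d - Dinv d i) * u$j * u$k)"
      unfolding U by (simp add: mult_ac)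
    finally have "u$i * (c * t$i + (2 * c\<^sup>2 - 1 - c) * u$i * w) =
        u$i * (- 2 * s\<^sup>2 * vol d * (Dsum d - Dinv d i) * u$j * u$k)" .
    then show "c * t$i + (2 * c\<^sup>2 - 1 - c) * u$i * w = - 2 * s\<^sup>2 * vol d * (Dsum d - Dinv d i) * u$j * u$k"
      using u0[of i] by (simp only: mult_cancel_left) simp
  qed
  show ?thesis
  proof (rule ex1I[of _ "rot u (\<phi>/2) t"])
    show "admitted d (\<lambda>x. rot u \<phi> x + rot u (\<phi>/2) t)" by (rule adm)
    fix b assume b: "admitted d (\<lambda>x. rot u \<phi> x + b)"
    define t' where "t' = rot u (- (\<phi>/2)) b"
    have bt: "b = rot u (\<phi>/2) t'" by (simp add: t'_def rot_half_cancel[OF u])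
    have adm': "admitted d (\<lambda>x. rot u \<phi> x + rot u (\<phi>/2) t')" using b unfolding bt .
    have "(2 * c\<^sup>2 - 1) * (u \<bullet> t') = (2 * c\<^sup>2 - 1) * w"
      unfolding w unfolding c_def s_def U_def
      using s by (intro admitted_imp_axis_equations(1)[OF u adm']) (simp add: s_def)
    then have wt': "u \<bullet> t' = w" using cos\<phi> by simp
    have "u$i * t'$i = u$i * t$i" for i
      using admitted_iff[OF u, THEN iffD1, OF adm'] s unfolding ut e_def wt' c_def s_def by blast
    then have "t' = t" using u0 by (simp add: vec_eq_iff)
    then show "b = rot u (\<phi>/2) t" by (simp add: bt)
  qed
qed

lemma third_b_eq:
  assumes "third_data d u \<phi>" "admitted d (\<lambda>x. rot u \<phi> x + b)"
  shows "third_b d u \<phi> = b"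
  unfolding third_b_def using third_unique[OF assms(1)] assms(2) by (rule the1_equality)

lemma first_kind_admitted:
  assumes "\<Phi> \<in> first_kind"
  shows "admitted d \<Phi>"
proof -
  obtain i \<phi> where \<Phi>: "\<Phi> = rot (ebasis i) \<phi>" using assms by (auto simp: first_kind_def)
  have u: "norm (ebasis i) = 1" by simp
  \<comment> \<open>For a coordinate axis and \<open>t = 0\<close>, \<open>w\<close> vanishes and so
    does every product of two different coordinates of the axis; all equations become
    trivial.\<close>
  have "admitted d (\<lambda>x. rot (ebasis i) \<phi> x + rot (ebasis i) (\<phi>/2) 0)"
    unfolding admitted_iff[OF u] by (auto simp: axis_def)
  then show ?thesis by (simp add: \<Phi> linear_0[OF linear_rot])
qed

text \<open>The half angle has cosine 0, which removes \<open>t$i\<close> from the second family. A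
  translation orthogonal to the axis gives \<open>w = 0\<close>, and products of different
  coordinates of the axis vanish.\<close>

lemma fifth_kind_admitted:
  assumes "\<Phi> \<in> fifth_kind"
  shows "admitted d \<Phi>"
proof -
  obtain i j k C1 C2 where ijk: "distinct [i, j, k]"
    and \<Phi>: "\<Phi> = (\<lambda>x. rot (ebasis i) pi x + (C1 *\<^sub>R ebasis j + C2 *\<^sub>R ebasis k))"
    using assms by (auto simp: fifth_kind_def)
  define b where "b = C1 *\<^sub>R ebasis j + C2 *\<^sub>R ebasis k"
  define t where "t = rot (ebasis i) (- (pi/2)) b"
  have u: "norm (ebasis i) = 1" by simp
  have "ebasis i \<bullet> t = rot (ebasis i) (- (pi/2)) (ebasis i) \<bullet> t" by (simp add: rot_axis_self)
  also have "\<dots> = ebasis i \<bullet> b" unfolding t_def by (rule inner_rot[OF u])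
  also have "\<dots> = 0" using ijk by (simp add: b_def inner_add_right inner_axis_axis)
  finally have w: "ebasis i \<bullet> t = 0" .
  then have ti: "t$i = 0" by (simp add: inner_axis')
  have "admitted d (\<lambda>x. rot (ebasis i) pi x + rot (ebasis i) (pi/2) t)"
    unfolding admitted_iff[OF u] w using ti by (auto simp: axis_def)
  then show ?thesis by (simp add: \<Phi> t_def rot_half_cancel[OF u] flip: b_def)
qed

lemma sixth_length_iff:
  "d$k = d$i * d$j / sqrt ((d$i)\<^sup>2 + (d$j)\<^sup>2) \<longleftrightarrow> Dinv d k = Dinv d i + Dinv d j"
proof -
  have pos: "d$i > 0" "d$j > 0" "d$k > 0" by (rule d_pos)+
  then have "(d$i)\<^sup>2 + (d$j)\<^sup>2 > 0" by (simp add: add_pos_pos)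
  have "d$k = d$i * d$j / sqrt ((d$i)\<^sup>2 + (d$j)\<^sup>2) \<longleftrightarrow>
      (d$k)\<^sup>2 = (d$i * d$j / sqrt ((d$i)\<^sup>2 + (d$j)\<^sup>2))\<^sup>2"
    using pos by (intro power2_eq_iff_nonneg[symmetric]) auto
  also have "\<dots> \<longleftrightarrow> (d$k)\<^sup>2 = (d$i)\<^sup>2 * (d$j)\<^sup>2 / ((d$i)\<^sup>2 + (d$j)\<^sup>2)"
    by (simp add: power_divide power_mult_distrib)
  also have "\<dots> \<longleftrightarrow> Dinv d k = Dinv d i + Dinv d j"
    using pos \<open>(d$i)\<^sup>2 + (d$j)\<^sup>2 > 0\<close> unfolding Dinv_def by (auto simp: field_simps)
  finally show ?thesis .
qed

text \<open>Here \<open>Dsum d\<close> is \<open>2 * (Dinv d i + Dinv d j)\<close>. The values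
  \<open>1 - 2 * Dinv d m / Dsum d\<close>, forced on the squared axis coordinates when
  \<open>w \<noteq> 0\<close> and \<open>u$k = 0\<close>, are thus those of a face diagonal.\<close>

lemma sixth_axis_squares:
  assumes ijk: "distinct [i, j, k]" and Dk: "Dinv d k = Dinv d i + Dinv d j"
  defines "r \<equiv> sqrt ((d$i)\<^sup>2 + (d$j)\<^sup>2)"
  shows "1 - 2 * Dinv d i / Dsum d = (d$i / r)\<^sup>2" "1 - 2 * Dinv d j / Dsum d = (d$j / r)\<^sup>2"
    "1 - 2 * Dinv d k / Dsum d = 0"
proof -
  have S: "Dsum d = 2 * (Dinv d i + Dinv d j)" using Dsum_distinct[OF ijk] Dk by simp
  have "d$i > 0" "d$j > 0" by (rule d_pos)+
  then have pos: "(d$i)\<^sup>2 > 0" "(d$j)\<^sup>2 > 0" by simp_all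
  then have r: "r\<^sup>2 = (d$i)\<^sup>2 + (d$j)\<^sup>2" by (simp add: r_def)
  have gen: "1 - 2 * (1 / a) / (2 * (1 / a + 1 / b)) = a / (a + b)" if "a > 0" "b > 0" for a b :: real
  proof -
    have ab: "1 / a + 1 / b = (a + b) / (a * b)" using that by (simp add: field_simps)
    have "2 * (1 / a) / (2 * (1 / a + 1 / b)) = 1 / a / (1 / a + 1 / b)"
      by (rule mult_divide_mult_cancel_left) simp
    also have "\<dots> = b / (a + b)" unfolding ab using that by simp
    finally have eq: "2 * (1 / a) / (2 * (1 / a + 1 / b)) = b / (a + b)" .
    show ?thesis unfolding eq using that by (simp add: field_simps)
  qed
  show "1 - 2 * Dinv d i / Dsum d = (d$i / r)\<^sup>2" 
    unfolding S Dinv_def power_divide r using pos by (rule gen)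
  show "1 - 2 * Dinv d j / Dsum d = (d$j / r)\<^sup>2"
    unfolding S Dinv_def power_divide r using gen[OF pos(2,1)] by (simp add: add.commute)
  show "1 - 2 * Dinv d k / Dsum d = 0" 
    unfolding S Dk using Dinv_pos[of i] Dinv_pos[of j] by simp
qed

text \<open>Adding \<open>\<mu> *\<^sub>R u\<close> to \<open>t\<close> makes
  \<open>w = \<mu>\<close>. For \<open>2 * c\<^sup>2 = 1\<close> the two new terms in the second
  family cancel, and the first family holds by the formula for \<open>(u$m)\<^sup>2\<close>. The
  rotation fixes \<open>u\<close>, so the translation part also changes by
  \<open>\<mu> *\<^sub>R u\<close>.\<close>

lemma sixth_motion_admitted:
  assumes u: "norm u = 1" and uk: "u$k = 0" and sq: "\<And>m. (u$m)\<^sup>2 = 1 - 2 * Dinv d m / Dsum d"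
    and cos2: "2 * (cos (\<phi>/2))\<^sup>2 = 1"
    and adm: "admitted d (inter_motion k u \<phi> \<tau>)"
  shows "admitted d (\<lambda>x. inter_motion k u \<phi> \<tau> x + \<mu> *\<^sub>R u)"
proof -
  define c s where "c = cos (\<phi>/2)" and "s = sin (\<phi>/2)"
  define t0 where "t0 = \<tau> *\<^sub>R ebasis k"
  have w0: "u \<bullet> t0 = 0" using uk by (simp add: t0_def inner_axis)
  have "u \<bullet> u = 1" using u by (simp add: norm_eq_1)
  then have w: "u \<bullet> (t0 + \<mu> *\<^sub>R u) = \<mu>" by (simp add: inner_add_right w0)
  have c2: "2 * c\<^sup>2 = 1" using cos2 by (simp add: c_def)
  have Y: "c * t0$i = - 2 * s\<^sup>2 * vol d * (Dsum d - Dinv d i) * u$j * u$k" if "distinct [i, j, k]" for i j k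
    using adm that unfolding inter_motion_eq admitted_iff[OF u] t0_def[symmetric] w0 c_def s_def by simp
  have X: "u$i * (t0 + \<mu> *\<^sub>R u)$i = \<mu> * (c + (1 - c) * (u$i)\<^sup>2 - 2 * c * Dinv d i / Dsum d)" for i
  proof -
    have "u$i * t0$i = 0" using uk by (simp add: t0_def axis_def)
    then have "u$i * (t0 + \<mu> *\<^sub>R u)$i = \<mu> * (u$i)\<^sup>2" by (simp add: algebra_simps power2_eq_square)
    also have "\<dots> = \<mu> * (c * (1 - 2 * Dinv d i / Dsum d) + (1 - c) * (u$i)\<^sup>2)"
      unfolding sq[symmetric] by (simp add: algebra_simps)
    finally show ?thesis by (simp add: algebra_simps)
  qed
  have "admitted d (\<lambda>x. rot u \<phi> x + rot u (\<phi>/2) (t0 + \<mu> *\<^sub>R u))"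
    unfolding admitted_iff[OF u] w c_def[symmetric] s_def[symmetric] c2
    using X by (auto simp: Y algebra_simps)
  moreover have "rot u (\<phi>/2) (t0 + \<mu> *\<^sub>R u) = rot u (\<phi>/2) t0 + \<mu> *\<^sub>R u"
    by (simp add: linear_add[OF linear_rot] linear_scale[OF linear_rot] rot_axis_self[OF u])
  ultimately show ?thesis by (simp add: inter_motion_eq t0_def add.assoc)
qed

lemma sixth_kind_admitted:
  assumes "\<Phi> \<in> sixth_kind d"
  shows "admitted d \<Phi>"
proof -
  obtain i j k \<epsilon> \<delta> u \<phi> \<mu> where ijk: "distinct [i, j, k]"
    and dk: "d$k = d$i * d$j / sqrt ((d$i)\<^sup>2 + (d$j)\<^sup>2)"
    and \<epsilon>\<delta>: "\<epsilon> \<in> {1, -1}" "\<delta> \<in> {1, -1}"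
    and u_def: "u = (1 / sqrt ((d$i)\<^sup>2 + (d$j)\<^sup>2)) *\<^sub>R ((\<epsilon> * d$i) *\<^sub>R ebasis i + (\<delta> * d$j) *\<^sub>R ebasis j)"
    and \<phi>: "\<phi> \<in> {pi / 2, - (pi / 2)}"
    and \<Phi>: "\<Phi> = (\<lambda>x. inter_motion k u \<phi> (inter_tau d k u \<phi>) x + \<mu> *\<^sub>R u)"
    using assms unfolding sixth_kind_def by blast
  note sq = sixth_axis_squares[OF ijk dk[unfolded sixth_length_iff]]
  have uk: "u$k = 0" using ijk by (auto simp: u_def axis_def)
  have usq: "(u$m)\<^sup>2 = 1 - 2 * Dinv d m / Dsum d" for m
    using distinct_3_exhaust[OF ijk, of m]
  proof (elim disjE)
    assume "m = i" then show ?thesis using sq(1) \<epsilon>\<delta> ijk by (auto simp: u_def axis_def power_divide)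
  next
    assume "m = j" then show ?thesis using sq(2) \<epsilon>\<delta> ijk by (auto simp: u_def axis_def power_divide)
  next
    assume "m = k" then show ?thesis using sq(3) uk by simp
  qed
  have "Dinv d 1 / Dsum d + Dinv d 2 / Dsum d + Dinv d 3 / Dsum d = 1"
    using Dsum_pos by (simp add: Dsum_def[symmetric] flip: add_divide_distrib)
  then have u: "norm u = 1"
    unfolding norm_1_components usq times_divide_eq_right[symmetric] by linarith
  have "cos \<phi> = 0" using \<phi> by (elim insertE emptyE) (simp_all only: cos_minus cos_pi_half)
  then have cos2: "2 * (cos (\<phi>/2))\<^sup>2 = 1" using cos_double_cos[of "\<phi>/2"] by simp
  then have "inter_data k u \<phi>" using u uk by (auto simp: inter_data_iff)
  then have "admitted d (inter_motion k u \<phi> (inter_tau d k u \<phi>))"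
    unfolding inter_tau_def by (rule theI'[OF inter_unique])
  then show ?thesis unfolding \<Phi> by (rule sixth_motion_admitted[OF u uk usq cos2])
qed

lemma admitted_imp_kind:
  assumes adm: "admitted d \<Phi>"
  shows "\<Phi> \<in> first_kind \<union> intermediate_kind d \<union> third_kind d \<union> fifth_kind \<union> sixth_kind d"
proof -
  obtain A b where A: "rotation_matrix A" and \<Phi>A: "\<Phi> = (\<lambda>x. A *v x + b)"
    using adm by (auto simp: admitted_def motion_def)
  obtain u \<phi> where u: "norm u = 1" and \<phi>: "0 \<le> \<phi>" "\<phi> \<le> pi" and Au: "\<And>x. A *v x = rot u \<phi> x"
    using rotation_matrix_imp_rot[OF A] by blast
  define t where "t = rot u (- (\<phi>/2)) b"
  have \<Phi>b: "\<Phi> = (\<lambda>x. rot u \<phi> x + b)" and bt: "b = rot u (\<phi>/2) t"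
    by (simp_all add: \<Phi>A Au t_def rot_half_cancel[OF u])
  have adm_b: "admitted d (\<lambda>x. rot u \<phi> x + b)" using adm unfolding \<Phi>b .
  then have adm_t: "admitted d (\<lambda>x. rot u \<phi> x + rot u (\<phi>/2) t)" unfolding bt .
  define c s w where "c = cos (\<phi>/2)" and "s = sin (\<phi>/2)" and "w = u \<bullet> t"
  note eqs = admitted_iff[OF u, THEN iffD1, OF adm_t, folded c_def s_def w_def]
  have Y: "c * t$i + (2 * c\<^sup>2 - 1 - c) * u$i * w = - 2 * s\<^sup>2 * vol d * (Dsum d - Dinv d i) * u$j * u$k"
    if "distinct [i, j, k]" for i j k using eqs that by blast
  have sc: "s\<^sup>2 + c\<^sup>2 = 1" by (simp add: s_def c_def)
  have c0: "c \<ge> 0" unfolding c_def using \<phi> by (intro cos_ge_zero) auto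
  show ?thesis
  proof (cases "s = 0")
    case True
    then have "c = 1" using sc c0 by (simp add: power2_eq_1_iff)
    \<comment> \<open>For \<open>c = 1\<close> the coefficient \<open>2 * c\<^sup>2 - 1 - c\<close>
      vanishes as well, so the second family reads \<open>t$i = 0\<close> and the motion is the
      identity.\<close>
    have "t$i = 0" for i
    proof -
      obtain j k where "distinct [j, k, i]" by (rule ex_distinct_3)
      then show ?thesis using Y[of i j k] \<open>c = 1\<close> True by auto
    qed
    then have "t = 0" by (simp add: vec_eq_iff)
    then have "b = 0" unfolding bt by (simp add: linear_0[OF linear_rot])
    moreover have "\<phi> = 0" using True \<phi> sin_gt_zero[of "\<phi>/2"] by (force simp: s_def)
    ultimately have "\<Phi> = rot (ebasis 1) 0" by (simp add: \<Phi>b fun_eq_iff)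
    then show ?thesis unfolding first_kind_def by blast
  next
    case False
    then have \<phi>0: "\<phi> > 0" using \<phi> by (cases "\<phi> = 0") (auto simp: s_def)
    note ax = admitted_imp_axis_equations[OF u adm_t False[unfolded s_def], folded c_def s_def w_def]
    have X: "u$i * t$i = w * (c + (1 - c) * (u$i)\<^sup>2 - 2 * c * Dinv d i / Dsum d)" for i
      using eqs False by blast
    have cos\<phi>: "cos \<phi> = 2 * c\<^sup>2 - 1" using cos_double_cos[of "\<phi>/2"] by (simp add: c_def)
    show ?thesis
    proof (cases "\<forall>i. u$i \<noteq> 0")
      case True
      define U where "U = u$1 * u$2 * u$3"
      have "U \<noteq> 0" using True by (simp add: U_def)
      define K where "K = 2 * s\<^sup>2 * vol d * U"
      have K: "K \<noteq> 0" using \<open>U \<noteq> 0\<close> False vol_pos by (simp add: K_def)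
      have w: "(2 * c\<^sup>2 - 1) * w = - 2 * K * Dsum d"
        using ax(1) by (simp add: K_def U_def algebra_simps)
      then have c2: "2 * c\<^sup>2 - 1 \<noteq> 0" using K Dsum_pos by auto
      \<comment> \<open>Elimination of \<open>w\<close>: the second axis equation is multiplied by
        \<open>2 * c\<^sup>2 - 1\<close>, the first is substituted, and the nonzero factor
        \<open>K * Dsum d\<close> is cancelled.\<close>
      have ui: "2 * s\<^sup>2 * Dsum d * (u$i)\<^sup>2 = Dsum d - (2 * c\<^sup>2 + 1) * Dinv d i" for i
      proof -
        define r where "r = Dinv d i / Dsum d"
        have Dr: "Dinv d i = r * Dsum d" using Dsum_pos by (simp add: r_def)
        have "w * (c\<^sup>2 * (1 - 2 * r) - s\<^sup>2 * (u$i)\<^sup>2) = - K * (Dsum d * (1 - r))"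
          using ax(2)[of i] Dsum_pos unfolding Dr K_def U_def by (simp add: algebra_simps)
        then have "(2 * c\<^sup>2 - 1) * w * (c\<^sup>2 * (1 - 2 * r) - s\<^sup>2 * (u$i)\<^sup>2) = (2 * c\<^sup>2 - 1) * (- K * (Dsum d * (1 - r)))"
          by (simp only: mult.assoc)
        then have "- K * Dsum d * (2 * (c\<^sup>2 * (1 - 2 * r) - s\<^sup>2 * (u$i)\<^sup>2)) = - K * Dsum d * ((2 * c\<^sup>2 - 1) * (1 - r))"
          unfolding w by (simp add: algebra_simps)
        then have "2 * (c\<^sup>2 * (1 - 2 * r) - s\<^sup>2 * (u$i)\<^sup>2) = (2 * c\<^sup>2 - 1) * (1 - r)"
          using K Dsum_pos by simp
        then have "2 * s\<^sup>2 * (u$i)\<^sup>2 = 1 - (2 * c\<^sup>2 + 1) * r" by (simp add: algebra_simps)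
        then have "Dsum d * (2 * s\<^sup>2 * (u$i)\<^sup>2) = Dsum d * (1 - (2 * c\<^sup>2 + 1) * r)" by simp
        then show ?thesis unfolding Dr by (simp add: algebra_simps)
      qed
      have "\<phi> \<noteq> pi / 2" using c2 unfolding cos\<phi>[symmetric] by (metis cos_pi_half)
      then have "third_data d u \<phi>"
        unfolding third_data_iff using u True ui \<phi>0 \<phi> pi_gt_zero
        by (auto simp: c_def s_def)
      then have "\<Phi> = (\<lambda>x. rot u \<phi> x + third_b d u \<phi>)"
        using third_b_eq[OF _ adm_b] by (simp add: \<Phi>b)
      with \<open>third_data d u \<phi>\<close> show ?thesis unfolding third_kind_def by blast
    next
      case False
      then obtain k where uk: "u$k = 0" by blast
      obtain i j where ijk: "distinct [i, j, k]" by (rule ex_distinct_3)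
      have jik: "distinct [j, i, k]" and kij: "distinct [k, i, j]" using ijk by auto
      have U: "u$1 * u$2 * u$3 = 0" using prod_distinct_3[OF ijk, of "\<lambda>i. u$i"] uk by simp
      have w2: "(2 * c\<^sup>2 - 1) * w = 0" using ax(1) U by simp
      have tvec: "t = t$i *\<^sub>R ebasis i + t$j *\<^sub>R ebasis j + t$k *\<^sub>R ebasis k" for t :: "real^3"
        unfolding vec_eq_iff
      proof
        fix m
        show "t$m = (t$i *\<^sub>R ebasis i + t$j *\<^sub>R ebasis j + t$k *\<^sub>R ebasis k)$m"
          using distinct_3_exhaust[OF ijk, of m] ijk by (auto simp: axis_def)
      qed
      have Yi: "c * t$i + (2 * c\<^sup>2 - 1 - c) * u$i * w = 0" using Y[OF ijk] uk by simp
      have Yj: "c * t$j + (2 * c\<^sup>2 - 1 - c) * u$j * w = 0" using Y[OF jik] uk by simp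
      have Yk: "c * t$k = - 2 * s\<^sup>2 * vol d * (Dsum d - Dinv d k) * u$i * u$j"
        using Y[OF kij] uk by simp
      \<comment> \<open>The component \<open>t$k\<close> satisfies the equation for
        \<open>\<tau>\<close> whatever \<open>w\<close> is, so it serves both the intermediate and
        the sixth kind.\<close>
      have inter: "admitted d (inter_motion k u \<phi> (t$k))"
        unfolding inter_motion_admitted_iff[OF u uk ijk] using Yk by (simp add: c_def s_def)
      have tau: "inter_tau d k u \<phi> = t$k" and data: "inter_data k u \<phi>" if "c \<noteq> 0"
        using that inter_tau_eq[OF _ inter] u uk by (auto simp: inter_data_iff c_def)
      show ?thesis
      proof (cases "w = 0")
        case w: True
        show ?thesis
        proof (cases "c = 0")
          case False
          then have "t = t$k *\<^sub>R ebasis k" using tvec[of t] Yi Yj w by simp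
          then have "\<Phi> = inter_motion k u \<phi> (inter_tau d k u \<phi>)"
            unfolding tau[OF False] inter_motion_eq \<Phi>b bt by simp
          then show ?thesis using data[OF False] unfolding intermediate_kind_def by blast
        next
          case True
          then have "\<phi> = pi"
          proof -
            have "\<phi> / 2 = pi / 2"
              using \<phi> True cos_gt_zero_pi[of "\<phi>/2"] by (cases "\<phi> < pi") (auto simp: c_def)
            then show ?thesis by simp
          qed
          have "s \<noteq> 0" using sc True by auto
          \<comment> \<open>With \<open>c = 0\<close> the equation for \<open>k\<close> leaves only
            this product, so the axis is a coordinate axis up to sign.\<close>
          have "u$i * u$j = 0"
            using Yk True \<open>s \<noteq> 0\<close> vol_pos Dsum_minus_Dinv_pos[of k] by simp
          then have "u$i = 0 \<or> u$j = 0" by simp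
          then have "u = u$j *\<^sub>R ebasis j \<or> u = u$i *\<^sub>R ebasis i"
            using tvec[of u] uk by auto
          then obtain m where um: "u = u$m *\<^sub>R ebasis m" by blast
          have "\<bar>u$m\<bar> = 1" using u by (subst (asm) um) simp
          then have "u$m = 1 \<or> u$m = - 1" by linarith
          then have "u = ebasis m \<or> u = - ebasis m" using um by (metis scaleR_minus1_left scaleR_one)
          \<comment> \<open>At angle \<open>pi\<close> the sine term vanishes and the remaining
            terms are even in the axis.\<close>
          then have rotm: "rot u pi x = rot (ebasis m) pi x" for x
            by (auto simp: rot_def)
          obtain p q where pq: "distinct [p, q, m]" by (rule ex_distinct_3)
          have "u \<bullet> b = rot u (\<phi>/2) u \<bullet> rot u (\<phi>/2) t" by (simp add: rot_axis_self[OF u] bt)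
          also have "\<dots> = 0" using w by (simp add: inner_rot[OF u] w_def)
          finally have "b$m = 0" using \<open>\<bar>u$m\<bar> = 1\<close> by (subst (asm) um) (auto simp: inner_axis')
          have "b = b$p *\<^sub>R ebasis p + b$q *\<^sub>R ebasis q"
            unfolding vec_eq_iff
          proof
            fix l
            show "b$l = (b$p *\<^sub>R ebasis p + b$q *\<^sub>R ebasis q)$l"
              using distinct_3_exhaust[OF pq, of l] pq \<open>b$m = 0\<close> by (auto simp: axis_def)
          qed
          then have "\<Phi> = (\<lambda>x. rot (ebasis m) pi x + (b$p *\<^sub>R ebasis p + b$q *\<^sub>R ebasis q))"
            unfolding \<Phi>b \<open>\<phi> = pi\<close> rotm by simp
          moreover have "distinct [m, p, q]" using pq by auto
          ultimately show ?thesis unfolding fifth_kind_def by blast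
        qed
      next
        case w: False
        then have c2: "2 * c\<^sup>2 = 1" using w2 by simp
        then have "c \<noteq> 0" by auto
        have "s\<^sup>2 = c\<^sup>2" using sc c2 by simp
        \<comment> \<open>The right-hand side of the second axis equation vanishes, and
          \<open>w\<close> and \<open>c\<close> can be cancelled.\<close>
        have sq: "(u$m)\<^sup>2 = 1 - 2 * Dinv d m / Dsum d" for m
        proof -
          have "w * (c\<^sup>2 * (1 - 2 * Dinv d m / Dsum d) - c\<^sup>2 * (u$m)\<^sup>2) = 0"
            using ax(2)[of m] unfolding U \<open>s\<^sup>2 = c\<^sup>2\<close> by simp
          then have "w * (c\<^sup>2 * (1 - 2 * Dinv d m / Dsum d - (u$m)\<^sup>2)) = 0"
            by (simp only: right_diff_distrib)
          then show ?thesis using \<open>c \<noteq> 0\<close> w by simp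
        qed
        have "2 * Dinv d k = Dsum d" using sq[of k] uk Dsum_pos by (simp add: field_simps)
        then have Dk: "Dinv d k = Dinv d i + Dinv d j" using Dsum_distinct[OF ijk] by simp
        define r where "r = sqrt ((d$i)\<^sup>2 + (d$j)\<^sup>2)"
        note sqr = sixth_axis_squares[OF ijk Dk, folded r_def]
        have "u$i = d$i / r \<or> u$i = - (d$i / r)" using sq[of i] sqr(1) power2_eq_iff by metis
        then obtain \<epsilon> where \<epsilon>: "\<epsilon> \<in> {1, -1}" "u$i = \<epsilon> * d$i / r" by force
        have "u$j = d$j / r \<or> u$j = - (d$j / r)" using sq[of j] sqr(2) power2_eq_iff by metis
        then obtain \<delta> where \<delta>: "\<delta> \<in> {1, -1}" "u$j = \<delta> * d$j / r" by force
        have ueq: "u = (1 / r) *\<^sub>R ((\<epsilon> * d$i) *\<^sub>R ebasis i + (\<delta> * d$j) *\<^sub>R ebasis j)"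
          using tvec[of u] unfolding uk \<epsilon>(2) \<delta>(2) by (simp add: scaleR_add_right)
        \<comment> \<open>For \<open>2 * c\<^sup>2 = 1\<close> the equations \<open>Yi\<close> and
          \<open>Yj\<close> are \<open>c\<close> times these.\<close>
        have "t$i = w * u$i" "t$j = w * u$j"
          using Yi Yj c2 \<open>c \<noteq> 0\<close> by (simp_all add: algebra_simps)
        have "t = t$k *\<^sub>R ebasis k + w *\<^sub>R u"
          unfolding vec_eq_iff
        proof
          fix m
          show "t$m = (t$k *\<^sub>R ebasis k + w *\<^sub>R u)$m"
            using distinct_3_exhaust[OF ijk, of m] ijk uk \<open>t$i = w * u$i\<close> \<open>t$j = w * u$j\<close> by (auto simp: axis_def)
        qed
        then have "rot u (\<phi>/2) t = rot u (\<phi>/2) (t$k *\<^sub>R ebasis k + w *\<^sub>R u)" by (rule arg_cong)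
        then have "b = t$k *\<^sub>R rot u (\<phi>/2) (ebasis k) + w *\<^sub>R u"
          by (simp only: bt linear_add[OF linear_rot] linear_scale[OF linear_rot] rot_axis_self[OF u])
        then have \<Phi>6: "\<Phi> = (\<lambda>x. inter_motion k u \<phi> (inter_tau d k u \<phi>) x + w *\<^sub>R u)"
          unfolding \<Phi>b tau[OF \<open>c \<noteq> 0\<close>] inter_motion_def by (simp add: add.assoc)
        have "\<phi> = pi / 2"
        proof -
          have "cos \<phi> = cos (pi / 2)" using cos\<phi> c2 by simp
          moreover have "0 \<le> pi / 2" "pi / 2 \<le> pi" using pi_gt_zero by linarith+
          ultimately show ?thesis using \<phi> cos_inj_pi by blast
        qed
        then have "\<phi> \<in> {pi / 2, - (pi / 2)}" by simp
        then show ?thesis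
          using ijk Dk[folded sixth_length_iff] \<epsilon>(1) \<delta>(1) ueq[unfolded r_def] \<Phi>6
          unfolding sixth_kind_def by blast
      qed
    qed
  qed
qed

end

theorem theorem1:
  fixes d :: "real^3"
  assumes "\<forall>i. d$i > 0"
  shows "(\<forall>k u \<phi>. inter_data k u \<phi> \<longrightarrow> (\<exists>!\<tau>. admitted d (inter_motion k u \<phi> \<tau>))) \<and>
         (\<forall>u \<phi>. third_data d u \<phi> \<longrightarrow> (\<exists>!b. admitted d (\<lambda>x. rot u \<phi> x + b))) \<and>
         {\<Phi>. admitted d \<Phi>} =
           first_kind \<union> intermediate_kind d \<union> third_kind d \<union> fifth_kind \<union> sixth_kind d"
proof -
  interpret parallelepiped d by unfold_locales (use assms in blast)
  have "admitted d \<Phi>" if "\<Phi> \<in> intermediate_kind d" for \<Phi>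
    using that theI'[OF inter_unique] by (auto simp: intermediate_kind_def inter_tau_def)
  moreover have "admitted d \<Phi>" if "\<Phi> \<in> third_kind d" for \<Phi>
    using that theI'[OF third_unique] by (auto simp: third_kind_def third_b_def)
  ultimately show ?thesis
    using inter_unique third_unique admitted_imp_kind first_kind_admitted fifth_kind_admitted sixth_kind_admitted
    by blast
qed

end
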